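(* For every $n\in\mathbb N$, the Fourier--Laplace transform $\mathcal L$ is a well-defined map $\mathcal L:L^2(\Omega^\ast,w_n)\to H(T_\Omega)$, it is injective, and its range is precisely $H^n_{2,\rho}(T_\Omega)$. Consequently, the formula $$\langle \mathcal L f,\mathcal L g\rangle_{H^n_{2,\rho}(T_\Omega)}:=\int_{\Omega^\ast} f(\xi)\overline{g(\xi)}\,w_n(\xi)\,d\xi,\qquad f,g\in L^2(\Omega^\ast,w_n),$$ defines an inner product on $H^n_{2,\rho}(T_\Omega)$, with respect to which $H^n_{2,\rho}(T_\Omega)$ is a Hilbert space. In particular, $\mathcal L$ is an isometric isomorphism from $L^2(\Omega^\ast,w_n)$ onto $H^n_{2,\rho}(T_\Omega)$.
   Context: Let $d\ge 1$ and let $\Omega\subset\mathbb R^d$ be a nonempty open convex cone containing no complete straight line. Its dual cone is $\Omega^\ast=\{\xi\in\mathbb R^d:\langle x,\xi\rangle\ge 0\text{ for all }x\in\Omega\}$, and $T_\Omega=\mathbb R^d+i\Omega\subset\mathbb C^d$ is the associated tube domain; $H(T_\Omega)$ is the space of holomorphic functions on $T_\Omega$. For $z\in\mathbb C^d$, $\xi\in\mathbb R^d$, $\langle z,\xi\rangle=\sum_{j=1}^d z_j\xi_j$ (bilinear). Fix a continuous function $\rho:\Omega^\ast\to[0,\infty)$ with $\rho(\xi)>0$ for $\xi\ne 0$ and $\rho(t\xi)=t\rho(\xi)$ for all $t>0$, $\xi\in\Omega^\ast$ (so $\rho(0)=0$). For $n\in\mathbb N$ let $w_n(\xi)=\sum_{k=0}^n\rho(\xi)^{2k}$,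 and let $L^2(\Omega^\ast,w_n)$ be the space of (classes of) measurable complex functions $f$ on $\Omega^\ast$ with $\|f\|_{L^2(\Omega^\ast,w_n)}^2=\int_{\Omega^\ast}|f(\xi)|^2w_n(\xi)\,d\xi<\infty$. The Fourier--Laplace transform of $f$ is $\mathcal Lf(z)=\int_{\Omega^\ast}e^{i\langle z,\xi\rangle}f(\xi)\,d\xi$, $z\in T_\Omega$. The Hilbertian Hardy--Sobolev space $H^n_{2,\rho}(T_\Omega)$ consists of all holomorphic functions $F$ on $T_\Omega$ of the form $F=\mathcal Lf$ for some $f\in L^2(\Omega^\ast,w_n)$, with norm $\|F\|_{H^n_{2,\rho}(T_\Omega)}=\inf\{\|f\|_{L^2(\Omega^\ast,w_n)}:F=\mathcal Lf\}$. *)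

theory Defs
  imports "HOL-Analysis.Analysis"
begin

record 'v vspace =
  vcarrier :: "'v set"
  vzero :: 'v
  vadd :: "'v \<Rightarrow> 'v \<Rightarrow> 'v"
  vscale :: "complex \<Rightarrow> 'v \<Rightarrow> 'v"

locale complex_vector_space =
  fixes V :: "'v vspace"
  assumes zero_closed: "vzero V \<in> vcarrier V"
    and add_closed: "\<lbrakk>x \<in> vcarrier V; y \<in> vcarrier V\<rbrakk> \<Longrightarrow> vadd V x y \<in> vcarrier V"
    and scale_closed: "x \<in> vcarrier V \<Longrightarrow> vscale V a x \<in> vcarrier V"
    and add_assoc: "\<lbrakk>x \<in> vcarrier V; y \<in> vcarrier V; z \<in> vcarrier V\<rbrakk>
          \<Longrightarrow> vadd V (vadd V x y) z = vadd V x (vadd V y z)"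
    and add_commute: "\<lbrakk>x \<in> vcarrier V; y \<in> vcarrier V\<rbrakk> \<Longrightarrow> vadd V x y = vadd V y x"
    and add_zero: "x \<in> vcarrier V \<Longrightarrow> vadd V x (vzero V) = x"
    and add_inverse: "x \<in> vcarrier V \<Longrightarrow> vadd V x (vscale V (- 1) x) = vzero V"
    and scale_add_right: "\<lbrakk>x \<in> vcarrier V; y \<in> vcarrier V\<rbrakk>
          \<Longrightarrow> vscale V a (vadd V x y) = vadd V (vscale V a x) (vscale V a y)"
    and scale_add_left: "x \<in> vcarrier V
          \<Longrightarrow> vscale V (a + b) x = vadd V (vscale V a x) (vscale V b x)"
    and scale_scale: "x \<in> vcarrier V \<Longrightarrow> vscale V a (vscale V b x) = vscale V (a * b) x"
    and scale_one: "x \<in> vcarrier V \<Longrightarrow> vscale V 1 x = x"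

locale complex_inner_product_space = complex_vector_space V
  for V :: "'v vspace" +
  fixes ip :: "'v \<Rightarrow> 'v \<Rightarrow> complex"
  assumes ip_add_left: "\<lbrakk>x \<in> vcarrier V; y \<in> vcarrier V; z \<in> vcarrier V\<rbrakk>
          \<Longrightarrow> ip (vadd V x y) z = ip x z + ip y z"
    and ip_scale_left: "\<lbrakk>x \<in> vcarrier V; y \<in> vcarrier V\<rbrakk> \<Longrightarrow> ip (vscale V a x) y = a * ip x y"
    and ip_cnj: "\<lbrakk>x \<in> vcarrier V; y \<in> vcarrier V\<rbrakk> \<Longrightarrow> ip x y = cnj (ip y x)"
    and ip_nonneg: "x \<in> vcarrier V \<Longrightarrow> 0 \<le> Re (ip x x)"
    and ip_definite: "\<lbrakk>x \<in> vcarrier V; ip x x = 0\<rbrakk> \<Longrightarrow> x = vzero V"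

definition ip_norm :: "('v \<Rightarrow> 'v \<Rightarrow> complex) \<Rightarrow> 'v \<Rightarrow> real" where
  "ip_norm ip x = sqrt (Re (ip x x))"

definition vdist :: "'v vspace \<Rightarrow> ('v \<Rightarrow> real) \<Rightarrow> 'v \<Rightarrow> 'v \<Rightarrow> real" where
  "vdist V N x y = N (vadd V x (vscale V (- 1) y))"

locale complex_hilbert_space = complex_inner_product_space V ip
  for V :: "'v vspace" and ip :: "'v \<Rightarrow> 'v \<Rightarrow> complex" +
  assumes complete:
    "\<lbrakk>\<And>k. s k \<in> vcarrier V;
      \<And>e. e > 0 \<Longrightarrow> \<exists>M. \<forall>j\<ge>M. \<forall>k\<ge>M. vdist V (ip_norm ip) (s j) (s k) < e\<rbrakk>
     \<Longrightarrow> \<exists>l\<in>vcarrier V. (\<lambda>k. vdist V (ip_norm ip) (s k) l) \<longlonglongrightarrow> 0"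

definition isometric_isomorphism ::
  "'v vspace \<Rightarrow> ('v \<Rightarrow> real) \<Rightarrow> 'w vspace \<Rightarrow> ('w \<Rightarrow> real) \<Rightarrow> ('v \<Rightarrow> 'w) \<Rightarrow> bool" where
  "isometric_isomorphism V NV W NW \<phi> \<longleftrightarrow>
     complex_vector_space V \<and> complex_vector_space W \<and>
     bij_betw \<phi> (vcarrier V) (vcarrier W) \<and>
     (\<forall>x\<in>vcarrier V. \<forall>y\<in>vcarrier V. \<phi> (vadd V x y) = vadd W (\<phi> x) (\<phi> y)) \<and>
     (\<forall>a. \<forall>x\<in>vcarrier V. \<phi> (vscale V a x) = vscale W a (\<phi> x)) \<and>
     (\<forall>x\<in>vcarrier V. NW (\<phi> x) = NV x)"

text \<open>The library's \<open>cone\<close> and \<open>conic\<close> require closure under multiplication by \<open>0\<close>, which no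
  proper open cone satisfies; hence only positive multiples here.\<close>

definition open_convex_cone :: "(real^'d) set \<Rightarrow> bool" where
  "open_convex_cone \<Omega> \<longleftrightarrow> open \<Omega> \<and> convex \<Omega> \<and> (\<forall>x\<in>\<Omega>. \<forall>t>0. t *\<^sub>R x \<in> \<Omega>)"

definition contains_line :: "(real^'d) set \<Rightarrow> bool" where
  "contains_line \<Omega> \<longleftrightarrow> (\<exists>a v. v \<noteq> 0 \<and> range (\<lambda>t::real. a + t *\<^sub>R v) \<subseteq> \<Omega>)"

definition dual_cone :: "(real^'d) set \<Rightarrow> (real^'d) set" where
  "dual_cone \<Omega> = {\<xi>. \<forall>x\<in>\<Omega>. 0 \<le> x \<bullet> \<xi>}"

definition tube :: "(real^'d) set \<Rightarrow> (complex^'d) set" where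
  "tube \<Omega> = {z. (\<chi> j. Im (z $ j)) \<in> \<Omega>}"

definition bilin :: "complex^'d \<Rightarrow> real^'d \<Rightarrow> complex" where
  "bilin z \<xi> = (\<Sum>j\<in>UNIV. z $ j * complex_of_real (\<xi> $ j))"

text \<open>A function on an open set \<open>U\<close> is represented by its extension by \<open>0\<close>, so that equality of
  functions on \<open>U\<close> is equality in HOL and the pointwise operations stay inside the representation.
  Holomorphic means that the Frechet derivative exists and is complex linear at each point.\<close>

definition holomorphic_functions :: "(complex^'d) set \<Rightarrow> (complex^'d \<Rightarrow> complex) set" where
  "holomorphic_functions U =
     {F. (\<forall>z\<in>U. \<exists>D. (F has_derivative D) (at z) \<and> (\<forall>c v. D (c *s v) = c * D v)) \<and>
         (\<forall>z. z \<notin> U \<longrightarrow> F z = 0)}"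

definition weight :: "(real^'d \<Rightarrow> real) \<Rightarrow> nat \<Rightarrow> real^'d \<Rightarrow> real" where
  "weight \<rho> n \<xi> = (\<Sum>k=0..n. \<rho> \<xi> ^ (2 * k))"

abbreviation dual_measure :: "(real^'d) set \<Rightarrow> (real^'d) measure" where
  "dual_measure \<Omega> \<equiv> lebesgue_on (dual_cone \<Omega>)"

definition L2_fun :: "(real^'d) set \<Rightarrow> (real^'d \<Rightarrow> real) \<Rightarrow> nat \<Rightarrow> (real^'d \<Rightarrow> complex) set" where
  "L2_fun \<Omega> \<rho> n = {f. f \<in> borel_measurable (dual_measure \<Omega>) \<and>
      integrable (dual_measure \<Omega>) (\<lambda>\<xi>. (cmod (f \<xi>))\<^sup>2 * weight \<rho> n \<xi>)}"

definition L2_fun_norm ::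
  "(real^'d) set \<Rightarrow> (real^'d \<Rightarrow> real) \<Rightarrow> nat \<Rightarrow> (real^'d \<Rightarrow> complex) \<Rightarrow> real" where
  "L2_fun_norm \<Omega> \<rho> n f =
     sqrt (integral\<^sup>L (dual_measure \<Omega>) (\<lambda>\<xi>. (cmod (f \<xi>))\<^sup>2 * weight \<rho> n \<xi>))"

definition L2_rel ::
  "(real^'d) set \<Rightarrow> (real^'d \<Rightarrow> real) \<Rightarrow> nat \<Rightarrow> (real^'d \<Rightarrow> complex) rel" where
  "L2_rel \<Omega> \<rho> n = {(f, g). f \<in> L2_fun \<Omega> \<rho> n \<and> g \<in> L2_fun \<Omega> \<rho> n \<and>
      (AE \<xi> in dual_measure \<Omega>. f \<xi> = g \<xi>)}"

definition L2 ::
  "(real^'d) set \<Rightarrow> (real^'d \<Rightarrow> real) \<Rightarrow> nat \<Rightarrow> (real^'d \<Rightarrow> complex) set vspace" where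
  "L2 \<Omega> \<rho> n = \<lparr>
     vcarrier = L2_fun \<Omega> \<rho> n // L2_rel \<Omega> \<rho> n,
     vzero = L2_rel \<Omega> \<rho> n `` {\<lambda>\<xi>. 0},
     vadd = (\<lambda>A B. \<Union>f\<in>A. \<Union>g\<in>B. L2_rel \<Omega> \<rho> n `` {\<lambda>\<xi>. f \<xi> + g \<xi>}),
     vscale = (\<lambda>a A. \<Union>f\<in>A. L2_rel \<Omega> \<rho> n `` {\<lambda>\<xi>. a * f \<xi>})\<rparr>"

definition L2_norm ::
  "(real^'d) set \<Rightarrow> (real^'d \<Rightarrow> real) \<Rightarrow> nat \<Rightarrow> (real^'d \<Rightarrow> complex) set \<Rightarrow> real" where
  "L2_norm \<Omega> \<rho> n A = the_elem (L2_fun_norm \<Omega> \<rho> n ` A)"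

definition FL_integrand :: "(real^'d \<Rightarrow> complex) \<Rightarrow> complex^'d \<Rightarrow> real^'d \<Rightarrow> complex" where
  "FL_integrand f z \<xi> = exp (\<i> * bilin z \<xi>) * f \<xi>"

definition FL :: "(real^'d) set \<Rightarrow> (real^'d \<Rightarrow> complex) \<Rightarrow> complex^'d \<Rightarrow> complex" where
  "FL \<Omega> f z = (if z \<in> tube \<Omega> then integral\<^sup>L (dual_measure \<Omega>) (FL_integrand f z) else 0)"

text \<open>\<^term>\<open>FL \<Omega> ` A\<close> is a singleton for an almost-everywhere class \<open>A\<close>; likewise for the norm in
  \<^const>\<open>L2_norm\<close>.\<close>

definition FL_class ::
  "(real^'d) set \<Rightarrow> (real^'d \<Rightarrow> complex) set \<Rightarrow> complex^'d \<Rightarrow> complex" where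
  "FL_class \<Omega> A = the_elem (FL \<Omega> ` A)"

definition hardy_sobolev ::
  "(real^'d) set \<Rightarrow> (real^'d \<Rightarrow> real) \<Rightarrow> nat \<Rightarrow> (complex^'d \<Rightarrow> complex) vspace" where
  "hardy_sobolev \<Omega> \<rho> n = \<lparr>
     vcarrier = {F \<in> holomorphic_functions (tube \<Omega>). \<exists>f\<in>L2_fun \<Omega> \<rho> n. F = FL \<Omega> f},
     vzero = (\<lambda>z. 0),
     vadd = (\<lambda>F G z. F z + G z),
     vscale = (\<lambda>a F z. a * F z)\<rparr>"

definition hs_norm ::
  "(real^'d) set \<Rightarrow> (real^'d \<Rightarrow> real) \<Rightarrow> nat \<Rightarrow> (complex^'d \<Rightarrow> complex) \<Rightarrow> real" where
  "hs_norm \<Omega> \<rho> n F = Inf {L2_fun_norm \<Omega> \<rho> n f | f. f \<in> L2_fun \<Omega> \<rho> n \<and> F = FL \<Omega> f}"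

end

theory Submission
  imports Defs
begin

text \<open>Three facts carry the theorem; the rest is transport along the resulting bijection between
  almost-everywhere classes and functions on the tube.

  \<^item> If a closed ball of radius \<open>r\<close> about \<open>y = Im z\<close> lies in the cone, then \<open>\<langle>y,\<xi>\<rangle> \<ge> r |\<xi>|\<close> on the dual
  cone (\<open>dual_cone_coercive\<close>), so the kernel \<open>e\<^bsup>i\<langle>z,\<xi>\<rangle>\<^esup>\<close> decays exponentially. It is therefore square
  integrable, which gives absolute convergence against any \<open>f\<close> in \<open>L\<^sup>2\<close>, and the decay absorbs the factor
  \<open>|\<xi>|\<^sup>2 e\<^bsup>|h||\<xi>|\<^esup>\<close> in the second order remainder of the kernel, which gives complex
  differentiability (\<open>FL_holomorphic\<close>). As \<open>w\<^sub>n \<ge> 1\<close>, the weighted space is contained in \<open>L\<^sup>2\<close>.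

  \<^item> The transform is injective already on the imaginary points \<open>z = iv\<close>, \<open>v \<in> \<Omega>\<close>, where it is a
  real Laplace transform (\<open>laplace_null_imp_AE_zero\<close>). Because \<open>\<Omega>\<close> is closed under addition,
  multiplication by \<open>e\<^bsup>-\<langle>w,\<xi>\<rangle>\<^esup>\<close> with \<open>w \<in> \<Omega>\<close> maps functions with vanishing Laplace transform to such
  functions. The multipliers with this property form an algebra closed under bounded pointwise
  limits, hence they are governed by a \<open>\<sigma>\<close>-algebra of sets. A sequence of polynomials in
  \<open>u = e\<^bsup>-\<langle>w,\<xi>\<rangle>\<^esup>\<close> converges to the indicator of \<open>u < 1/2\<close>, so this \<open>\<sigma>\<close>-algebra contains
  half-spaces, and as \<open>\<Omega>\<close> is open, all Borel sets. A function with vanishing transform thus has integral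
  zero over every measurable set and vanishes almost everywhere.

  \<^item> The weighted \<open>L\<^sup>2\<close> space is complete (\<open>complete_L2\<close>).

  By injectivity the set of representatives in the definition of the Hardy--Sobolev norm is a single
  class, so the infimum is the common norm of its members, and the inner product can be defined
  by choosing a representative.\<close>

section \<open>Weighted square-integrable functions\<close>

locale weighted_L2 =
  fixes M :: "'a measure" and w :: "'a \<Rightarrow> real"
  assumes weight_measurable [measurable]: "w \<in> borel_measurable M"
    and weight_ge_1: "x \<in> space M \<Longrightarrow> 1 \<le> w x"
begin

definition sq_integrable :: "('a \<Rightarrow> complex) \<Rightarrow> bool" where
  "sq_integrable f \<longleftrightarrow>
     f \<in> borel_measurable M \<and> integrable M (\<lambda>x. (cmod (f x))\<^sup>2 * w x)"

definition norm_sq :: "('a \<Rightarrow> complex) \<Rightarrow> real" where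
  "norm_sq f = integral\<^sup>L M (\<lambda>x. (cmod (f x))\<^sup>2 * w x)"

lemma weight_nonneg: "x \<in> space M \<Longrightarrow> 0 \<le> w x"
  using weight_ge_1[of x] by simp

lemma norm_sq_nonneg: "0 \<le> norm_sq f"
  unfolding norm_sq_def by (rule Bochner_Integration.integral_nonneg) (simp add: weight_nonneg)

lemma sq_integrable_measurable: "sq_integrable f \<Longrightarrow> f \<in> borel_measurable M"
  by (simp add: sq_integrable_def)

lemma sq_integrable_zero: "sq_integrable (\<lambda>x. 0)"
  by (simp add: sq_integrable_def)

lemma sq_integrable_scale:
  assumes "sq_integrable f" shows "sq_integrable (\<lambda>x. a * f x)"
proof -
  have "integrable M (\<lambda>x. (cmod a)\<^sup>2 * ((cmod (f x))\<^sup>2 * w x))"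
    using assms by (simp add: sq_integrable_def)
  moreover have "(cmod (a * f x))\<^sup>2 * w x = (cmod a)\<^sup>2 * ((cmod (f x))\<^sup>2 * w x)" for x
    by (simp add: norm_mult power_mult_distrib)
  ultimately have "integrable M (\<lambda>x. (cmod (a * f x))\<^sup>2 * w x)" by presburger
  moreover have "(\<lambda>x. a * f x) \<in> borel_measurable M"
    using sq_integrable_measurable[OF assms] by measurable
  ultimately show ?thesis by (simp add: sq_integrable_def)
qed

lemma cmod_add_sq_le: "(cmod (a + b))\<^sup>2 \<le> 2 * (cmod a)\<^sup>2 + 2 * (cmod b)\<^sup>2"
proof -
  have "(cmod (a + b))\<^sup>2 \<le> (cmod a + cmod b)\<^sup>2"
    by (simp add: norm_triangle_ineq power_mono)
  also have "\<dots> \<le> 2 * (cmod a)\<^sup>2 + 2 * (cmod b)\<^sup>2"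
    using sum_squares_bound[of "cmod a" "cmod b"] by (simp add: power2_sum)
  finally show ?thesis .
qed

lemma sq_integrable_add:
  assumes "sq_integrable f" "sq_integrable g" shows "sq_integrable (\<lambda>x. f x + g x)"
proof -
  have [measurable]: "f \<in> borel_measurable M" "g \<in> borel_measurable M"
    using assms by (simp_all add: sq_integrable_def)
  have "integrable M (\<lambda>x. 2 * ((cmod (f x))\<^sup>2 * w x) + 2 * ((cmod (g x))\<^sup>2 * w x))"
    using assms by (simp add: sq_integrable_def)
  then have "integrable M (\<lambda>x. (cmod (f x + g x))\<^sup>2 * w x)"
  proof (rule Bochner_Integration.integrable_bound)
    show "AE x in M. norm ((cmod (f x + g x))\<^sup>2 * w x)
        \<le> norm (2 * ((cmod (f x))\<^sup>2 * w x) + 2 * ((cmod (g x))\<^sup>2 * w x))"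
    proof (rule AE_I2)
      fix x assume x: "x \<in> space M"
      have "(cmod (f x + g x))\<^sup>2 * w x \<le> (2 * (cmod (f x))\<^sup>2 + 2 * (cmod (g x))\<^sup>2) * w x"
        by (intro mult_right_mono cmod_add_sq_le weight_nonneg[OF x])
      then show "norm ((cmod (f x + g x))\<^sup>2 * w x)
        \<le> norm (2 * ((cmod (f x))\<^sup>2 * w x) + 2 * ((cmod (g x))\<^sup>2 * w x))"
        using weight_nonneg[OF x] by (simp add: algebra_simps)
    qed
  qed measurable
  then show ?thesis by (simp add: sq_integrable_def)
qed

lemma sq_integrable_diff:
  assumes "sq_integrable f" "sq_integrable g" shows "sq_integrable (\<lambda>x. f x - g x)"
  using sq_integrable_add[OF assms(1) sq_integrable_scale[OF assms(2), of "-1"]] by simp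

text \<open>The pointwise inequality \<open>|ab| \<le> |a|\<^sup>2 + |b|\<^sup>2\<close>, multiplied by the weight, gives an integrable
  majorant.\<close>

lemma integrable_mult_weight:
  assumes "sq_integrable f" "sq_integrable g"
  shows "integrable M (\<lambda>x. f x * cnj (g x) * complex_of_real (w x))"
proof -
  have [measurable]: "cnj \<in> borel_measurable borel"
    by (intro borel_measurable_continuous_onI continuous_on_cnj continuous_on_id)
  have [measurable]: "f \<in> borel_measurable M" "g \<in> borel_measurable M"
    using assms by (simp_all add: sq_integrable_def)
  have "integrable M (\<lambda>x. (cmod (f x))\<^sup>2 * w x + (cmod (g x))\<^sup>2 * w x)"
    using assms by (simp add: sq_integrable_def)
  then show ?thesis
  proof (rule Bochner_Integration.integrable_bound)
    show "AE x in M. norm (f x * cnj (g x) * complex_of_real (w x))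
        \<le> norm ((cmod (f x))\<^sup>2 * w x + (cmod (g x))\<^sup>2 * w x)"
    proof (rule AE_I2)
      fix x assume x: "x \<in> space M"
      have "cmod (f x) * cmod (g x) \<le> (cmod (f x))\<^sup>2 + (cmod (g x))\<^sup>2"
        using sum_squares_bound[of "cmod (f x)" "cmod (g x)"]
          mult_nonneg_nonneg[OF norm_ge_zero[of "f x"] norm_ge_zero[of "g x"]] by linarith
      then have "cmod (f x) * cmod (g x) * w x \<le> ((cmod (f x))\<^sup>2 + (cmod (g x))\<^sup>2) * w x"
        by (intro mult_right_mono weight_nonneg[OF x])
      then show "norm (f x * cnj (g x) * complex_of_real (w x))
        \<le> norm ((cmod (f x))\<^sup>2 * w x + (cmod (g x))\<^sup>2 * w x)"
        using weight_nonneg[OF x] by (simp add: norm_mult algebra_simps)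
    qed
  qed measurable
qed

lemma norm_sq_eq_0_imp_AE:
  assumes "sq_integrable f" "norm_sq f = 0" shows "AE x in M. f x = 0"
proof -
  have "AE x in M. (cmod (f x))\<^sup>2 * w x = 0"
    using assms integral_nonneg_eq_0_iff_AE[of M "\<lambda>x. (cmod (f x))\<^sup>2 * w x"]
    by (auto simp: sq_integrable_def norm_sq_def weight_nonneg)
  then show ?thesis
    by (rule AE_mp, intro AE_I2) (auto dest: weight_ge_1)
qed

lemma norm_sq_cong_AE:
  assumes "AE x in M. f x = g x" "sq_integrable f" "sq_integrable g"
  shows "norm_sq f = norm_sq g"
  unfolding norm_sq_def using assms by (intro integral_cong_AE) (auto simp: sq_integrable_def)

lemma nn_integral_norm_sq:
  assumes "sq_integrable f"
  shows "(\<integral>\<^sup>+x. ennreal ((cmod (f x))\<^sup>2 * w x) \<partial>M) = ennreal (norm_sq f)"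
  unfolding norm_sq_def
  using assms by (intro nn_integral_eq_integral) (auto simp: sq_integrable_def weight_nonneg)

lemma sq_integrable_if_nn_integral_le:
  assumes "f \<in> borel_measurable M" "0 \<le> e"
    and "(\<integral>\<^sup>+x. ennreal ((cmod (f x))\<^sup>2 * w x) \<partial>M) \<le> ennreal e"
  shows "sq_integrable f" and "norm_sq f \<le> e"
proof -
  note [measurable] = assms(1)
  have "(\<integral>\<^sup>+x. ennreal ((cmod (f x))\<^sup>2 * w x) \<partial>M) < \<infinity>"
    using assms(3) by (rule le_less_trans) simp
  then have "integrable M (\<lambda>x. (cmod (f x))\<^sup>2 * w x)"
    by (intro integrableI_nonneg) (auto simp: weight_nonneg)
  then show *: "sq_integrable f" using assms by (simp add: sq_integrable_def)
  show "norm_sq f \<le> e"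
    using assms(2,3) nn_integral_norm_sq[OF *] by (simp add: norm_sq_nonneg)
qed

text \<open>The bound \<open>8\<^sup>-\<^sup>k\<close> leaves room for a factor \<open>4\<^sup>k\<close>: \<open>\<Sum> 4\<^sup>k |d\<^sub>k|\<^sup>2 w\<close> then has finite
  integral, hence is finite almost everywhere, and at such a point \<open>|d\<^sub>k|\<close> is at most a constant times
  \<open>2\<^sup>-\<^sup>k\<close>, because \<open>w \<ge> 1\<close>.\<close>

lemma AE_summable_increments:
  assumes d: "\<And>k. sq_integrable (d k)" and b: "\<And>k. norm_sq (d k) \<le> (1/8) ^ k"
  shows "AE x in M. summable (\<lambda>k. d k x)"
proof -
  have [measurable]: "d k \<in> borel_measurable M" for k
    using d by (simp add: sq_integrable_def)
  let ?t = "\<lambda>k x. ennreal (4 ^ k * ((cmod (d k x))\<^sup>2 * w x))"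
  have "(\<integral>\<^sup>+x. ?t k x \<partial>M) \<le> ennreal ((1/2) ^ k)" for k
  proof -
    have "(\<integral>\<^sup>+x. ?t k x \<partial>M) = (\<integral>\<^sup>+x. ennreal (4^k) * ennreal ((cmod (d k x))\<^sup>2 * w x) \<partial>M)"
      by (intro nn_integral_cong ennreal_mult) (auto simp: weight_nonneg)
    also have "\<dots> = ennreal (4^k) * ennreal (norm_sq (d k))"
      by (subst nn_integral_cmult) (auto simp: nn_integral_norm_sq[OF d])
    also have "\<dots> = ennreal (4^k * norm_sq (d k))"
      by (simp add: ennreal_mult norm_sq_nonneg)
    also have "\<dots> \<le> ennreal (4^k * (1/8)^k)"
      by (intro ennreal_leI mult_left_mono b) simp
    also have "4^k * (1/8)^k = (1/2::real)^k"
      by (simp add: power_mult_distrib[symmetric])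
    finally show ?thesis .
  qed
  then have "(\<integral>\<^sup>+x. (\<Sum>k. ?t k x) \<partial>M) \<le> (\<Sum>k. ennreal ((1/2) ^ k))"
    by (subst nn_integral_suminf) (auto intro!: suminf_le)
  also have "\<dots> = ennreal (\<Sum>k. (1/2) ^ k)"
    by (intro suminf_ennreal2) (auto simp: summable_geometric)
  also have "\<dots> < \<infinity>" by simp
  finally have "(\<integral>\<^sup>+x. (\<Sum>k. ?t k x) \<partial>M) \<noteq> \<infinity>" by simp
  then have "AE x in M. (\<Sum>k. ?t k x) \<noteq> \<infinity>"
    by (intro nn_integral_PInf_AE) auto
  then show ?thesis
  proof (rule AE_mp, intro AE_I2 impI)
    fix x assume x: "x \<in> space M" and fin: "(\<Sum>k. ?t k x) \<noteq> \<infinity>"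
    then obtain C where C: "0 \<le> C" "(\<Sum>k. ?t k x) = ennreal C"
      by (cases "\<Sum>k. ?t k x") auto
    have bound: "norm (d k x) \<le> sqrt C * (1/2)^k" for k
    proof -
      have "?t k x \<le> (\<Sum>k. ?t k x)"
        using sum_le_suminf[of "\<lambda>k. ?t k x" "{k}"] by simp
      then have "4 ^ k * ((cmod (d k x))\<^sup>2 * w x) \<le> C"
        using C by simp
      moreover have "4 ^ k * (cmod (d k x))\<^sup>2 * 1 \<le> 4 ^ k * (cmod (d k x))\<^sup>2 * w x"
        by (intro mult_left_mono weight_ge_1 x) simp
      moreover have "4 ^ k * (cmod (d k x))\<^sup>2 = (2 ^ k * cmod (d k x))\<^sup>2"
        using power_mult_distrib[of 2 "2::real" k] by (simp add: power2_eq_square mult_ac)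
      ultimately have "(2 ^ k * cmod (d k x))\<^sup>2 \<le> C"
        by (metis mult.assoc mult.right_neutral order_trans)
      then have "2 ^ k * cmod (d k x) \<le> sqrt C" by (simp add: real_le_rsqrt)
      then have "(2 ^ k * cmod (d k x)) * (1/2) ^ k \<le> sqrt C * (1/2) ^ k"
        by (rule mult_right_mono) simp
      then show ?thesis by (simp add: power_one_over)
    qed
    have "summable (\<lambda>k. sqrt C * (1/2) ^ k)"
      by (rule summable_mult[OF summable_geometric]) simp
    then show "summable (\<lambda>k. d k x)"
      by (rule summable_comparison_test'[where N = 0]) (rule bound)
  qed
qed

text \<open>Riesz--Fischer: a rapidly convergent subsequence has almost everywhere summable increments, and
  Fatou's lemma identifies its pointwise limit as the limit of the whole sequence in norm.\<close>

lemma complete_L2: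
  assumes s: "\<And>k. sq_integrable (s k)"
    and cauchy: "\<And>e. e > 0 \<Longrightarrow> \<exists>K. \<forall>j\<ge>K. \<forall>k\<ge>K. norm_sq (\<lambda>x. s j x - s k x) < e"
  obtains l where "sq_integrable l" "(\<lambda>k. norm_sq (\<lambda>x. s k x - l x)) \<longlonglongrightarrow> 0"
proof -
  have [measurable]: "s k \<in> borel_measurable M" for k
    using s by (simp add: sq_integrable_def)
  have "\<forall>i. \<exists>K. \<forall>j\<ge>K. \<forall>k\<ge>K. norm_sq (\<lambda>x. s j x - s k x) < (1/8) ^ i"
    by (intro allI cauchy) simp
  then obtain N where N: "\<And>i j k. j \<ge> N i \<Longrightarrow> k \<ge> N i \<Longrightarrow> norm_sq (\<lambda>x. s j x - s k x) < (1/8) ^ i"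
    by metis
  \<comment> \<open>a monotone choice of indices that dominates both \<open>k\<close> and \<open>N k\<close>\<close>
  define r where "r k = k + (\<Sum>i\<le>k. N i)" for k
  have r_N: "N k \<le> r k" for k
    unfolding r_def using member_le_sum[of k "{..k}" N] by simp
  have r_mono: "r k \<le> r (Suc k)" for k by (simp add: r_def)
  have r_ge: "k \<le> r k" for k by (simp add: r_def)
  define d where "d k x = s (r (Suc k)) x - s (r k) x" for k x
  define l where "l x = lim (\<lambda>k. s (r k) x)" for x
  have [measurable]: "l \<in> borel_measurable M"
    unfolding l_def by measurable
  have "AE x in M. summable (\<lambda>k. d k x)"
  proof (rule AE_summable_increments)
    show "sq_integrable (d k)" for k
      unfolding d_def by (intro sq_integrable_diff s)
    show "norm_sq (d k) \<le> (1/8) ^ k" for k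
      using N[where i=k and j="r (Suc k)" and k="r k"] r_N[of k] r_mono[of k]
      by (simp add: d_def[abs_def])
  qed
  then have lim: "AE x in M. (\<lambda>k. s (r k) x) \<longlonglongrightarrow> l x"
  proof (rule AE_mp, intro AE_I2 impI)
    fix x assume "summable (\<lambda>k. d k x)"
    then have "(\<lambda>n. \<Sum>k<n. d k x) \<longlonglongrightarrow> (\<Sum>k. d k x)" by (rule summable_LIMSEQ)
    moreover have "(\<Sum>k<n. d k x) = s (r n) x - s (r 0) x" for n
      unfolding d_def by (rule sum_lessThan_telescope)
    ultimately have "(\<lambda>n. s (r n) x - s (r 0) x) \<longlonglongrightarrow> (\<Sum>k. d k x)" by simp
    from tendsto_add[OF this tendsto_const[of "s (r 0) x"]]
    have "convergent (\<lambda>n. s (r n) x)" by (auto simp: convergent_def)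
    then show "(\<lambda>k. s (r k) x) \<longlonglongrightarrow> l x"
      by (simp add: l_def convergent_LIMSEQ_iff)
  qed
  have fatou: "(\<integral>\<^sup>+x. ennreal ((cmod (s j x - l x))\<^sup>2 * w x) \<partial>M) \<le> ennreal e"
    if "0 < e" and K: "\<forall>j\<ge>K. \<forall>k\<ge>K. norm_sq (\<lambda>x. s j x - s k x) < e" "j \<ge> K" for e K j
  proof -
    have "(\<integral>\<^sup>+x. ennreal ((cmod (s j x - l x))\<^sup>2 * w x) \<partial>M)
        = (\<integral>\<^sup>+x. liminf (\<lambda>k. ennreal ((cmod (s j x - s (r k) x))\<^sup>2 * w x)) \<partial>M)"
    proof (rule nn_integral_cong_AE, rule AE_mp[OF lim], intro AE_I2 impI)
      fix x assume "(\<lambda>k. s (r k) x) \<longlonglongrightarrow> l x"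
      then have "(\<lambda>k. ennreal ((cmod (s j x - s (r k) x))\<^sup>2 * w x))
          \<longlonglongrightarrow> ennreal ((cmod (s j x - l x))\<^sup>2 * w x)"
        by (intro tendsto_intros)
      then show "ennreal ((cmod (s j x - l x))\<^sup>2 * w x)
          = liminf (\<lambda>k. ennreal ((cmod (s j x - s (r k) x))\<^sup>2 * w x))"
        by (simp add: lim_imp_Liminf)
    qed
    also have "\<dots> \<le> liminf (\<lambda>k. \<integral>\<^sup>+x. ennreal ((cmod (s j x - s (r k) x))\<^sup>2 * w x) \<partial>M)"
      by (rule nn_integral_liminf) measurable
    also have "\<dots> = liminf (\<lambda>k. ennreal (norm_sq (\<lambda>x. s j x - s (r k) x)))"
      by (simp add: nn_integral_norm_sq sq_integrable_diff s)
    also have "\<dots> \<le> limsup (\<lambda>k. ennreal (norm_sq (\<lambda>x. s j x - s (r k) x)))"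
      by (rule Liminf_le_Limsup) simp
    also have "\<dots> \<le> ennreal e"
    proof (rule Limsup_bounded, rule eventually_sequentiallyI[of K])
      fix k assume "K \<le> k"
      then have "r k \<ge> K" using r_ge[of k] by simp
      then show "ennreal (norm_sq (\<lambda>x. s j x - s (r k) x)) \<le> ennreal e"
        using K by (intro ennreal_leI less_imp_le) auto
    qed
    finally show ?thesis .
  qed
  obtain K1 where K1: "\<forall>j\<ge>K1. \<forall>k\<ge>K1. norm_sq (\<lambda>x. s j x - s k x) < 1"
    using cauchy[of 1] by auto
  have "sq_integrable (\<lambda>x. s K1 x - l x)"
    using sq_integrable_if_nn_integral_le(1)[OF _ _ fatou[of 1 K1 K1]] K1 by auto
  from sq_integrable_diff[OF s[of K1] this] have l: "sq_integrable l" by simp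
  have "(\<lambda>k. norm_sq (\<lambda>x. s k x - l x)) \<longlonglongrightarrow> 0"
  proof (rule LIMSEQ_I)
    fix e :: real assume "e > 0"
    then obtain K where K: "\<forall>j\<ge>K. \<forall>k\<ge>K. norm_sq (\<lambda>x. s j x - s k x) < e/2"
      using cauchy[of "e/2"] by auto
    have "norm_sq (\<lambda>x. s j x - l x) \<le> e/2" if "j \<ge> K" for j
      using sq_integrable_if_nn_integral_le(2)[OF _ _ fatou[of "e/2" K j]] K that \<open>e > 0\<close> by auto
    then show "\<exists>K. \<forall>j\<ge>K. norm (norm_sq (\<lambda>x. s j x - l x) - 0) < e"
      using \<open>e > 0\<close> norm_sq_nonneg by (intro exI[of _ K]) (force intro: le_less_trans)
  qed
  with l show thesis by (rule that)
qed

end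

section \<open>Convergence and holomorphy of the Fourier--Laplace integral\<close>

abbreviation imag_part :: "complex^'d \<Rightarrow> real^'d" where
  "imag_part z \<equiv> \<chi> j. Im (z $ j)"

lemma cone_scale: "open_convex_cone \<Omega> \<Longrightarrow> x \<in> \<Omega> \<Longrightarrow> 0 < t \<Longrightarrow> t *\<^sub>R x \<in> \<Omega>"
  by (simp add: open_convex_cone_def)

lemma cone_add:
  assumes "open_convex_cone \<Omega>" "x \<in> \<Omega>" "y \<in> \<Omega>" shows "x + y \<in> \<Omega>"
proof -
  have "(1/2) *\<^sub>R x + (1/2) *\<^sub>R y \<in> \<Omega>"
    using assms by (intro convexD) (auto simp: open_convex_cone_def)
  from cone_scale[OF assms(1) this, of 2] show ?thesis
    by (simp add: algebra_simps)
qed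

lemma closed_dual_cone: "closed (dual_cone \<Omega>)"
proof -
  have "dual_cone \<Omega> = (\<Inter>x\<in>\<Omega>. {\<xi>. 0 \<le> x \<bullet> \<xi>})" by (auto simp: dual_cone_def)
  then show ?thesis by (simp add: closed_INT closed_halfspace_component_ge closed_halfspace_ge)
qed

lemma dual_cone_lebesgue [measurable]: "dual_cone \<Omega> \<in> sets lebesgue"
  by (intro sets_completionI_sets) (simp add: borel_closed closed_dual_cone)

lemma space_dual_measure [simp]: "space (dual_measure \<Omega>) = dual_cone \<Omega>"
  by (simp add: space_restrict_space)

lemma borel_imp_dual_measurable:
  "g \<in> borel_measurable borel \<Longrightarrow> g \<in> borel_measurable (dual_measure \<Omega>)"
  by (intro measurable_restrict_space1 measurable_completion) simp

lemma continuous_imp_dual_measurable: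
  fixes g :: "real^'d \<Rightarrow> 'b::topological_space"
  shows "continuous_on UNIV g \<Longrightarrow> g \<in> borel_measurable (dual_measure \<Omega>)"
  by (intro borel_imp_dual_measurable borel_measurable_continuous_onI)

text \<open>Test the definition of the dual cone on the point of the ball that lies farthest from \<open>y\<close> in
  direction \<open>-\<xi>\<close>.\<close>

lemma dual_cone_coercive:
  assumes "cball y r \<subseteq> \<Omega>" "0 < r" "\<xi> \<in> dual_cone \<Omega>"
  shows "r * norm \<xi> \<le> y \<bullet> \<xi>"
proof (cases "\<xi> = 0")
  case False
  have "y - (r / norm \<xi>) *\<^sub>R \<xi> \<in> cball y r"
    using assms(2) False by (simp add: dist_norm)
  then have "y - (r / norm \<xi>) *\<^sub>R \<xi> \<in> \<Omega>" using assms(1) by blast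
  then have "0 \<le> (y - (r / norm \<xi>) *\<^sub>R \<xi>) \<bullet> \<xi>"
    using assms(3) unfolding dual_cone_def by blast
  also have "\<dots> = y \<bullet> \<xi> - r * norm \<xi>"
    using False by (simp add: inner_diff_left power2_norm_eq_inner[symmetric] power2_eq_square)
  finally show ?thesis by simp
qed simp

lemma nn_integral_exp_abs_finite:
  fixes a :: real assumes "0 < a"
  shows "(\<integral>\<^sup>+x. ennreal (exp (- (a * \<bar>x\<bar>))) \<partial>lborel) < \<infinity>"
proof -
  let ?f = "\<lambda>x. ennreal (exp (- (a * x)))"
  have half: "(\<integral>\<^sup>+x. ?f x * indicator {0..} x \<partial>lborel) < \<infinity>"
  proof (subst nn_integral_FTC_atLeast[where F = "\<lambda>x. - (exp (- (a * x)) / a)" and T = 0])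
    show "DERIV (\<lambda>x. - (exp (- (a * x)) / a)) x :> exp (- (a * x))" for x
      using assms by (auto intro!: derivative_eq_intros)
    have "LIM x at_top. - (a * x) :> at_bot"
      using assms filterlim_tendsto_pos_mult_at_top[OF tendsto_const assms filterlim_ident]
      by (simp add: filterlim_uminus_at_bot)
    then have "((\<lambda>x. exp (- (a * x))) \<longlongrightarrow> 0) at_top"
      by (rule filterlim_compose[OF exp_at_bot])
    then show "((\<lambda>x. - (exp (- (a * x)) / a)) \<longlongrightarrow> 0) at_top"
      using tendsto_minus[OF tendsto_divide[OF _ tendsto_const[of a]]] assms by fastforce
  qed simp_all
  have "(\<integral>\<^sup>+x. ennreal (exp (- (a * \<bar>x\<bar>))) \<partial>lborel)
      \<le> (\<integral>\<^sup>+x. (?f x * indicator {0..} x + ?f (-x) * indicator {0..} (-x)) \<partial>lborel)"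
    by (intro nn_integral_mono) (auto simp: indicator_def)
  also have "\<dots> = (\<integral>\<^sup>+x. ?f x * indicator {0..} x \<partial>lborel)
      + (\<integral>\<^sup>+x. ?f (-x) * indicator {0..} (-x) \<partial>lborel)"
    by (intro nn_integral_add) auto
  also have "(\<integral>\<^sup>+x. ?f (-x) * indicator {0..} (-x) \<partial>lborel)
      = (\<integral>\<^sup>+x. ?f x * indicator {0..} x \<partial>lborel)"
    using nn_integral_real_affine[of "\<lambda>x. ?f x * indicator {0..} x" "-1" 0] by simp
  also have "(\<integral>\<^sup>+x. ?f x * indicator {0..} x \<partial>lborel)
      + (\<integral>\<^sup>+x. ?f x * indicator {0..} x \<partial>lborel) < \<infinity>"
    using half by (simp add: ennreal_add_less_top)
  finally show ?thesis .
qed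

text \<open>The Euclidean norm dominates the average of the moduli of the coordinates, so the function is at most
  a product of one-dimensional integrable functions.\<close>

lemma integrable_exp_norm:
  fixes c :: real assumes "0 < c"
  shows "integrable lborel (\<lambda>x::'a::euclidean_space. exp (- (c * norm x)))"
proof -
  define a where "a = c / DIM('a)"
  have a: "0 < a" using assms by (simp add: a_def)
  have le: "exp (- (c * norm x)) \<le> (\<Prod>b\<in>Basis. exp (- (a * \<bar>x \<bullet> b\<bar>)))" for x :: 'a
  proof -
    have "(\<Sum>b\<in>Basis. \<bar>x \<bullet> b\<bar>) \<le> (\<Sum>b\<in>(Basis::'a set). norm x)"
      by (intro sum_mono Basis_le_norm)
    then have "a * (\<Sum>b\<in>Basis. \<bar>x \<bullet> b\<bar>) \<le> a * (DIM('a) * norm x)"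
      using a by (intro mult_left_mono) auto
    also have "\<dots> = c * norm x" by (simp add: a_def)
    finally show ?thesis
      by (simp add: exp_sum[symmetric] sum_negf sum_distrib_left)
  qed
  have "(\<integral>\<^sup>+x. ennreal (exp (- (c * norm x))) \<partial>(lborel::'a measure))
      \<le> (\<integral>\<^sup>+x. (\<Prod>b\<in>Basis. ennreal (exp (- (a * \<bar>x \<bullet> b\<bar>)))) \<partial>(lborel::'a measure))"
    using le by (intro nn_integral_mono) (simp add: prod_ennreal ennreal_leI)
  also have "\<dots> = (\<Prod>b\<in>(Basis::'a set). \<integral>\<^sup>+x. ennreal (exp (- (a * \<bar>x\<bar>))) \<partial>lborel)"
    by (rule nn_integral_lborel_prod) simp_all
  also have "\<dots> < \<infinity>"
    using nn_integral_exp_abs_finite[OF a] by (simp add: power_less_top_ennreal)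
  finally show ?thesis by (intro integrableI_nonneg) auto
qed

lemma exp_decay_integrable:
  assumes "0 < c"
  shows "integrable (dual_measure \<Omega>) (\<lambda>\<xi>. exp (- (c * norm \<xi>)))"
proof -
  have "integrable lebesgue (\<lambda>\<xi>. indicator (dual_cone \<Omega>) \<xi> *\<^sub>R exp (- (c * norm \<xi>)))"
    using integrable_exp_norm[OF assms] dual_cone_lebesgue
    by (intro integrable_mult_indicator) (simp_all add: integrable_completion)
  then show ?thesis by (simp add: integrable_restrict_space)
qed

text \<open>The product of two square-integrable functions is integrable.\<close>

lemma exp_decay_mult_integrable:
  assumes "0 < c" and [measurable]: "f \<in> borel_measurable (dual_measure \<Omega>)"
    and "integrable (dual_measure \<Omega>) (\<lambda>\<xi>. (cmod (f \<xi>))\<^sup>2)"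
  shows "integrable (dual_measure \<Omega>) (\<lambda>\<xi>. exp (- (c * norm \<xi>)) * cmod (f \<xi>))"
proof -
  have [measurable]: "(\<lambda>\<xi>. exp (- (c * norm \<xi>))) \<in> borel_measurable (dual_measure \<Omega>)"
    by (intro continuous_imp_dual_measurable continuous_intros)
  have "integrable (dual_measure \<Omega>) (\<lambda>\<xi>. exp (- (2 * c * norm \<xi>)) + (cmod (f \<xi>))\<^sup>2)"
    using assms by (intro Bochner_Integration.integrable_add exp_decay_integrable) auto
  then show ?thesis
  proof (rule Bochner_Integration.integrable_bound)
    have "exp (- (c * norm \<xi>)) * cmod (f \<xi>) \<le> exp (- (2 * c * norm \<xi>)) + (cmod (f \<xi>))\<^sup>2" for \<xi>
    proof -
      have "exp (- (2 * c * norm \<xi>)) = (exp (- (c * norm \<xi>)))\<^sup>2"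
        by (simp add: exp_double[symmetric])
      then show ?thesis
        using sum_squares_bound[of "exp (- (c * norm \<xi>))" "cmod (f \<xi>)"]
          mult_nonneg_nonneg[OF exp_ge_zero[of "- (c * norm \<xi>)"] norm_ge_zero[of "f \<xi>"]]
        by linarith
    qed
    then show "AE \<xi> in dual_measure \<Omega>. norm (exp (- (c * norm \<xi>)) * cmod (f \<xi>))
        \<le> norm (exp (- (2 * c * norm \<xi>)) + (cmod (f \<xi>))\<^sup>2)"
      by (intro AE_I2) (simp add: abs_mult)
  qed measurable
qed

lemma continuous_bilin: "continuous_on UNIV (bilin z)"
  unfolding bilin_def[abs_def] by (intro continuous_intros)

lemma bilin_add: "bilin (z + h) \<xi> = bilin z \<xi> + bilin h \<xi>"
  by (simp add: bilin_def distrib_right sum.distrib)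

lemma bilin_scale: "bilin (c *s h) \<xi> = c * bilin h \<xi>"
  by (simp add: bilin_def sum_distrib_left mult.assoc)

lemma Im_bilin: "Im (bilin z \<xi>) = imag_part z \<bullet> \<xi>"
  by (simp add: bilin_def inner_vec_def)

lemma cmod_exp_bilin: "cmod (exp (\<i> * bilin z \<xi>)) = exp (- (imag_part z \<bullet> \<xi>))"
  by (simp add: norm_exp_eq_Re Im_bilin)

lemma cmod_bilin_le: "cmod (bilin h \<xi>) \<le> norm h * norm \<xi>"
proof -
  have "cmod (bilin h \<xi>) \<le> (\<Sum>j\<in>UNIV. \<bar>cmod (h $ j)\<bar> * \<bar>\<xi> $ j\<bar>)"
    unfolding bilin_def by (rule sum_norm_le) (simp add: norm_mult)
  also have "\<dots> \<le> L2_set (\<lambda>j. cmod (h $ j)) UNIV * L2_set (\<lambda>j. \<xi> $ j) UNIV"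
    by (rule L2_set_mult_ineq)
  also have "\<dots> = norm h * norm \<xi>" by (simp add: norm_vec_def L2_set_def)
  finally show ?thesis .
qed

lemma norm_imag_part_le: "norm (imag_part h) \<le> norm h"
  unfolding norm_vec_def by (intro L2_set_mono) (simp_all add: abs_Im_le_cmod)

lemma FL_integrand_measurable:
  assumes [measurable]: "f \<in> borel_measurable (dual_measure \<Omega>)"
  shows "FL_integrand f z \<in> borel_measurable (dual_measure \<Omega>)"
proof -
  have [measurable]: "bilin z \<in> borel_measurable (dual_measure \<Omega>)"
    by (intro continuous_imp_dual_measurable continuous_bilin)
  show ?thesis unfolding FL_integrand_def[abs_def] by measurable
qed

text \<open>The modulus of the kernel depends only on the imaginary part of \<open>z\<close>, so coercivity applies.\<close>

lemma cmod_FL_integrand_le: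
  assumes "cball (imag_part z) r \<subseteq> \<Omega>" "0 < r" "\<xi> \<in> dual_cone \<Omega>"
  shows "cmod (FL_integrand f z \<xi>) \<le> exp (- (r * norm \<xi>)) * cmod (f \<xi>)"
  using dual_cone_coercive[OF assms]
  unfolding FL_integrand_def norm_mult cmod_exp_bilin by (intro mult_right_mono) auto

lemma FL_integrand_integrable:
  assumes "open \<Omega>" "z \<in> tube \<Omega>" and f: "f \<in> borel_measurable (dual_measure \<Omega>)"
    and f2: "integrable (dual_measure \<Omega>) (\<lambda>\<xi>. (cmod (f \<xi>))\<^sup>2)"
  shows "integrable (dual_measure \<Omega>) (FL_integrand f z)"
proof -
  obtain r where r: "0 < r" "cball (imag_part z) r \<subseteq> \<Omega>"
    using assms(1,2) by (auto simp: tube_def open_contains_cball)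
  show ?thesis
    by (rule Bochner_Integration.integrable_bound[OF exp_decay_mult_integrable[OF r(1) f f2]
          FL_integrand_measurable[OF f]])
       (auto intro!: order_trans[OF cmod_FL_integrand_le[OF r(2,1)]])
qed

text \<open>The next two estimates control the second order remainder of the kernel: the first bounds it by
  \<open>|h|\<^sup>2 |\<xi>|\<^sup>2\<close> times an exponential in \<open>|h||\<xi>|\<close>, and the second trades \<open>|\<xi>|\<^sup>2\<close> for a further exponential.\<close>

lemma exp_remainder_bound: "cmod (exp w - 1 - w) \<le> exp (cmod w) * (cmod w)\<^sup>2"
  using Taylor_exp_field[of w 1] by (simp add: algebra_simps power2_eq_square)

lemma square_le_exp: fixes t :: real assumes "0 \<le> t" shows "t\<^sup>2 \<le> 4 * exp t"
proof -
  have "(t/2)\<^sup>2 \<le> (exp (t/2))\<^sup>2"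
    using assms exp_ge_add_one_self[of "t/2"] by (intro power_mono) linarith+
  then show ?thesis by (simp add: power_divide exp_double[symmetric])
qed

text \<open>Differentiation under the integral sign, done by a direct estimate. Of the decay rate \<open>r\<close> of the kernel,
  a quarter is spent on the remainder of the exponential (for \<open>|h| \<le> r/4\<close>) and a quarter on the factor
  \<open>|\<xi>|\<^sup>2\<close>. The remaining rate \<open>r/2\<close> is integrable against \<open>f\<close>, so the remainder of the integral is of
  order \<open>|h|\<^sup>2\<close>.\<close>

lemma FL_holomorphic:
  assumes "open \<Omega>" and f: "f \<in> borel_measurable (dual_measure \<Omega>)"
    and f2: "integrable (dual_measure \<Omega>) (\<lambda>\<xi>. (cmod (f \<xi>))\<^sup>2)"
  shows "FL \<Omega> f \<in> holomorphic_functions (tube \<Omega>)"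
proof -
  have "\<exists>D. (FL \<Omega> f has_derivative D) (at z) \<and> (\<forall>c v. D (c *s v) = c * D v)"
    if z: "z \<in> tube \<Omega>" for z
  proof -
    obtain r where r: "0 < r" "cball (imag_part z) r \<subseteq> \<Omega>"
      using assms(1) z by (auto simp: tube_def open_contains_cball)
    let ?M = "dual_measure \<Omega>"
    let ?I = "\<lambda>h \<xi>. \<i> * bilin h \<xi> * FL_integrand f z \<xi>"
    define D where "D h = integral\<^sup>L ?M (?I h)" for h
    note [measurable] = f FL_integrand_measurable[OF f]
    have bilin_meas [measurable]: "bilin h \<in> borel_measurable ?M" for h
      by (intro continuous_imp_dual_measurable continuous_bilin)
    have exp_int: "integrable ?M (\<lambda>\<xi>. exp (- (r/2 * norm \<xi>)) * cmod (f \<xi>))"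
      using r by (intro exp_decay_mult_integrable f f2) simp
    define B where "B = integral\<^sup>L ?M (\<lambda>\<xi>. exp (- (r/2 * norm \<xi>)) * cmod (f \<xi>))"
    \<comment> \<open>one factor \<open>|\<xi>|\<close> costs half of the decay rate: \<open>t \<le> e\<^sup>t\<close> with \<open>t = r|\<xi>|/2\<close>\<close>
    have I_le: "cmod (?I h \<xi>) \<le> (2 / r * norm h) * (exp (- (r/2 * norm \<xi>)) * cmod (f \<xi>))"
      if "\<xi> \<in> dual_cone \<Omega>" for h \<xi>
    proof -
      have "r/2 * norm \<xi> \<le> exp (r/2 * norm \<xi>)"
        using exp_ge_add_one_self[of "r/2 * norm \<xi>"] by linarith
      then have n: "norm \<xi> \<le> 2 / r * exp (r/2 * norm \<xi>)"
        using r by (simp add: field_simps)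
      have "cmod (?I h \<xi>) \<le> (norm h * norm \<xi>) * (exp (- (r * norm \<xi>)) * cmod (f \<xi>))"
        unfolding norm_mult norm_ii mult_1
        by (intro mult_mono cmod_bilin_le cmod_FL_integrand_le[OF r(2,1) that]) auto
      also have "\<dots> \<le> (norm h * (2 / r * exp (r/2 * norm \<xi>))) * (exp (- (r * norm \<xi>)) * cmod (f \<xi>))"
        by (intro mult_right_mono mult_left_mono n) auto
      also have "\<dots> = (2 / r * norm h) * ((exp (r/2 * norm \<xi>) * exp (- (r * norm \<xi>))) * cmod (f \<xi>))"
        by (simp only: mult_ac)
      also have "exp (r/2 * norm \<xi>) * exp (- (r * norm \<xi>)) = exp (- (r/2 * norm \<xi>))"
        by (simp add: exp_add[symmetric])
      finally show ?thesis .
    qed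
    have I_int: "integrable ?M (?I h)" for h
      by (rule Bochner_Integration.integrable_bound[OF integrable_mult_right[OF exp_int, of "2 / r * norm h"]])
         (use r I_le in \<open>auto simp: abs_mult\<close>)
    have D_le: "norm (D h) \<le> norm h * (2 / r * B)" for h
    proof -
      have "norm (D h) \<le> (LINT \<xi>|?M. (2 / r * norm h) * (exp (- (r/2 * norm \<xi>)) * cmod (f \<xi>)))"
        unfolding D_def
        by (rule Bochner_Integration.integral_norm_bound_integral)
           (use I_int exp_int I_le in auto)
      also have "\<dots> = norm h * (2 / r * B)" by (simp add: B_def)
      finally show ?thesis .
    qed
    have D_add: "D (h + k) = D h + D k" for h k
    proof -
      have "?I (h + k) = (\<lambda>\<xi>. ?I h \<xi> + ?I k \<xi>)"
        by (rule ext) (simp add: bilin_add algebra_simps)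
      then show ?thesis unfolding D_def
        using Bochner_Integration.integral_add[OF I_int[of h] I_int[of k]] by simp
    qed
    have D_scale: "D (c *s h) = c * D h" for c h
    proof -
      have "?I (c *s h) = (\<lambda>\<xi>. c * ?I h \<xi>)"
        by (rule ext) (simp add: bilin_scale algebra_simps)
      then show ?thesis unfolding D_def by simp
    qed
    have D_bl: "bounded_linear D"
    proof (rule bounded_linear_intro[OF D_add _ D_le])
      show "D (c *\<^sub>R h) = c *\<^sub>R D h" for c h
      proof -
        have "c *\<^sub>R h = complex_of_real c *s h" 
          by (simp add: vec_eq_iff scaleR_conv_of_real[where 'a = complex])
        then show ?thesis using D_scale[of "complex_of_real c" h] by (simp add: scaleR_conv_of_real)
      qed
    qed
    have rem: "norm (FL \<Omega> f (z + h) - FL \<Omega> f z - D h) \<le> (64 / r\<^sup>2 * B) * (norm h)\<^sup>2"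
      if h: "norm h \<le> r / 4" for h
    proof -
      have "imag_part (z + h) - imag_part z = imag_part h" by (simp add: vec_eq_iff)
      then have "dist (imag_part z) (imag_part (z + h)) \<le> norm h"
        using norm_imag_part_le[of h] by (metis dist_commute dist_norm)
      then have zh: "z + h \<in> tube \<Omega>" using r h by (auto simp: tube_def)
      let ?J = "\<lambda>\<xi>. FL_integrand f (z + h) \<xi> - FL_integrand f z \<xi> - ?I h \<xi>"
      have J_le: "cmod (?J \<xi>) \<le> (64 / r\<^sup>2 * (norm h)\<^sup>2) * (exp (- (r/2 * norm \<xi>)) * cmod (f \<xi>))"
        if xi: "\<xi> \<in> dual_cone \<Omega>" for \<xi>
      proof -
        let ?w = "\<i> * bilin h \<xi>"
        have w: "cmod ?w \<le> norm h * norm \<xi>" using cmod_bilin_le[of h \<xi>] by (simp add: norm_mult)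
        have "norm h * norm \<xi> \<le> r / 4 * norm \<xi>" by (intro mult_right_mono h) simp
        with w have w4: "cmod ?w \<le> r / 4 * norm \<xi>" by linarith
        have "(r / 4 * norm \<xi>)\<^sup>2 \<le> 4 * exp (r / 4 * norm \<xi>)"
          using r by (intro square_le_exp) simp
        then have sq: "(norm \<xi>)\<^sup>2 \<le> 64 / r\<^sup>2 * exp (r / 4 * norm \<xi>)"
          using r by (simp add: power_mult_distrib power_divide field_simps)
        have "(cmod ?w)\<^sup>2 \<le> (norm h * norm \<xi>)\<^sup>2"
          by (intro power_mono w) simp
        also have "\<dots> \<le> (norm h)\<^sup>2 * (64 / r\<^sup>2 * exp (r / 4 * norm \<xi>))"
          unfolding power_mult_distrib by (intro mult_left_mono sq) simp
        finally have w2: "(cmod ?w)\<^sup>2 \<le> (norm h)\<^sup>2 * (64 / r\<^sup>2 * exp (r / 4 * norm \<xi>))" .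
        have "?J \<xi> = (exp ?w - 1 - ?w) * FL_integrand f z \<xi>"
          by (simp add: FL_integrand_def bilin_add distrib_left exp_add algebra_simps)
        then have "cmod (?J \<xi>) = cmod (exp ?w - 1 - ?w) * cmod (FL_integrand f z \<xi>)"
          by (simp only: norm_mult)
        also have "\<dots> \<le> (exp (cmod ?w) * (cmod ?w)\<^sup>2) * (exp (- (r * norm \<xi>)) * cmod (f \<xi>))"
          by (intro mult_mono exp_remainder_bound cmod_FL_integrand_le[OF r(2,1) xi]) auto
        also have "\<dots> \<le> (exp (r / 4 * norm \<xi>) * ((norm h)\<^sup>2 * (64 / r\<^sup>2 * exp (r / 4 * norm \<xi>))))
            * (exp (- (r * norm \<xi>)) * cmod (f \<xi>))"
          by (intro mult_right_mono mult_mono w2) (use w4 in auto)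
        also have "\<dots> = (64 / r\<^sup>2 * (norm h)\<^sup>2) *
            ((exp (r / 4 * norm \<xi>) * exp (r / 4 * norm \<xi>) * exp (- (r * norm \<xi>))) * cmod (f \<xi>))"
          by (simp only: mult_ac)
        also have "exp (r / 4 * norm \<xi>) * exp (r / 4 * norm \<xi>) * exp (- (r * norm \<xi>))
            = exp (- (r/2 * norm \<xi>))"
          by (simp add: exp_add[symmetric])
        finally show ?thesis .
      qed
      have ints: "integrable ?M (FL_integrand f (z + h))" "integrable ?M (FL_integrand f z)"
        using FL_integrand_integrable[OF assms(1) _ f f2] z zh by auto
      have "FL \<Omega> f (z + h) - FL \<Omega> f z - D h = integral\<^sup>L ?M ?J"
        using z zh ints I_int by (simp add: FL_def D_def)
      also have "norm \<dots> \<le> (LINT \<xi>|?M. (64 / r\<^sup>2 * (norm h)\<^sup>2) * (exp (- (r/2 * norm \<xi>)) * cmod (f \<xi>)))"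
        by (rule Bochner_Integration.integral_norm_bound_integral) (use ints I_int exp_int J_le in auto)
      also have "\<dots> = (64 / r\<^sup>2 * B) * (norm h)\<^sup>2" by (simp add: B_def)
      finally show ?thesis .
    qed
    have "(\<lambda>h. norm (FL \<Omega> f (z + h) - FL \<Omega> f z - D h) / norm h) \<midarrow>0\<rightarrow> 0"
    proof (rule Lim_null_comparison)
      show "((\<lambda>h. (64 / r\<^sup>2 * B) * norm h) \<longlongrightarrow> 0) (at (0::complex^'a))"
        by (intro tendsto_mult_right_zero tendsto_norm_zero tendsto_ident_at)
      show "\<forall>\<^sub>F h in at (0::complex^'a).
          norm (norm (FL \<Omega> f (z + h) - FL \<Omega> f z - D h) / norm h) \<le> (64 / r\<^sup>2 * B) * norm h"
        unfolding eventually_at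
      proof (intro exI[of _ "r/4"] conjI ballI impI)
        fix h :: "complex^'a" assume "h \<noteq> 0 \<and> dist h 0 < r / 4"
        then show "norm (norm (FL \<Omega> f (z + h) - FL \<Omega> f z - D h) / norm h) \<le> (64 / r\<^sup>2 * B) * norm h"
          using rem[of h] by (simp add: divide_le_eq power2_eq_square mult.assoc)
      qed (use r in simp)
    qed
    then have "(FL \<Omega> f has_derivative D) (at z)"
      using D_bl by (simp add: has_derivative_at)
    then show ?thesis using D_scale by blast
  qed
  then show ?thesis by (simp add: holomorphic_functions_def FL_def)
qed

section \<open>Injectivity of the Laplace transform on a cone\<close>

text \<open>Integrability is part of the definition because the integral of a function that is not integrable is \<open>0\<close> by
  convention.\<close>

definition laplace_null :: "(real^'d) set \<Rightarrow> (real^'d \<Rightarrow> complex) \<Rightarrow> bool" where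
  "laplace_null \<Omega> G \<longleftrightarrow> (\<forall>v\<in>\<Omega>.
     integrable (dual_measure \<Omega>) (\<lambda>\<xi>. exp (- (v \<bullet> \<xi>)) *\<^sub>R G \<xi>) \<and>
     integral\<^sup>L (dual_measure \<Omega>) (\<lambda>\<xi>. exp (- (v \<bullet> \<xi>)) *\<^sub>R G \<xi>) = 0)"

text \<open>The point of passing from functions \<open>G\<close> with vanishing Laplace transform to their multipliers is that
  the multipliers form an algebra, so that it is enough to produce few of them explicitly.\<close>

definition null_multiplier :: "(real^'d) set \<Rightarrow> (real^'d \<Rightarrow> real) \<Rightarrow> bool" where
  "null_multiplier \<Omega> m \<longleftrightarrow>
     (\<forall>G. laplace_null \<Omega> G \<longrightarrow> laplace_null \<Omega> (\<lambda>\<xi>. m \<xi> *\<^sub>R G \<xi>))"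

lemma null_multiplier_const: "null_multiplier \<Omega> (\<lambda>\<xi>. c)"
  unfolding null_multiplier_def laplace_null_def
  by (simp add: scaleR_left_commute[of _ c] del: scaleR_scaleR)

lemma null_multiplier_add:
  assumes "null_multiplier \<Omega> m" "null_multiplier \<Omega> m'"
  shows "null_multiplier \<Omega> (\<lambda>\<xi>. m \<xi> + m' \<xi>)"
  using assms unfolding null_multiplier_def laplace_null_def
  by (auto simp: scaleR_add_left scaleR_add_right simp del: integrable_scaleR_right)

lemma null_multiplier_mult:
  assumes "null_multiplier \<Omega> m" "null_multiplier \<Omega> m'"
  shows "null_multiplier \<Omega> (\<lambda>\<xi>. m \<xi> * m' \<xi>)"
  unfolding null_multiplier_def
proof (intro allI impI)
  fix G assume "laplace_null \<Omega> G"
  then have "laplace_null \<Omega> (\<lambda>\<xi>. m \<xi> *\<^sub>R (m' \<xi> *\<^sub>R G \<xi>))"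
    using assms by (simp only: null_multiplier_def)
  then show "laplace_null \<Omega> (\<lambda>\<xi>. (m \<xi> * m' \<xi>) *\<^sub>R G \<xi>)" by simp
qed

lemma null_multiplier_diff:
  assumes "null_multiplier \<Omega> m" "null_multiplier \<Omega> m'"
  shows "null_multiplier \<Omega> (\<lambda>\<xi>. m \<xi> - m' \<xi>)"
  using null_multiplier_add[OF assms(1)
      null_multiplier_mult[OF null_multiplier_const[of \<Omega> "-1"] assms(2)]] by simp

lemma null_multiplier_power:
  assumes "null_multiplier \<Omega> m" shows "null_multiplier \<Omega> (\<lambda>\<xi>. m \<xi> ^ k)"
proof (induction k)
  case 0 then show ?case using null_multiplier_const[of \<Omega> 1] by simp
next
  case (Suc k) then show ?case using null_multiplier_mult[OF assms] by simp
qed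

text \<open>Multiplication by this exponential shifts the argument of the Laplace transform from \<open>v\<close> to \<open>v + w\<close>,
  which stays in the cone.\<close>

lemma null_multiplier_exp:
  assumes "open_convex_cone \<Omega>" "w \<in> \<Omega>"
  shows "null_multiplier \<Omega> (\<lambda>\<xi>. exp (- (w \<bullet> \<xi>)))"
  unfolding null_multiplier_def
proof (intro allI impI)
  fix G assume G: "laplace_null \<Omega> G"
  have eq: "exp (- (v \<bullet> \<xi>)) *\<^sub>R (exp (- (w \<bullet> \<xi>)) *\<^sub>R G \<xi>) = exp (- ((v + w) \<bullet> \<xi>)) *\<^sub>R G \<xi>"
    for v \<xi> by (simp add: inner_add_left exp_add[symmetric])
  show "laplace_null \<Omega> (\<lambda>\<xi>. exp (- (w \<bullet> \<xi>)) *\<^sub>R G \<xi>)"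
    using G cone_add[OF assms(1) _ assms(2)] unfolding laplace_null_def eq by blast
qed

text \<open>Dominated convergence. Bounds and limits refer to the dual cone because it carries the measure; for the same
  reason values of multipliers off the dual cone do not matter.\<close>

lemma null_multiplier_limit:
  assumes m: "\<And>k. null_multiplier \<Omega> (m k)"
    and bound: "\<And>k \<xi>. \<xi> \<in> dual_cone \<Omega> \<Longrightarrow> \<bar>m k \<xi>\<bar> \<le> 1"
    and lim: "\<And>\<xi>. \<xi> \<in> dual_cone \<Omega> \<Longrightarrow> (\<lambda>k. m k \<xi>) \<longlonglongrightarrow> l \<xi>"
  shows "null_multiplier \<Omega> l"
  unfolding null_multiplier_def
proof (intro allI impI)
  fix G assume G: "laplace_null \<Omega> G"
  let ?M = "dual_measure \<Omega>"
  show "laplace_null \<Omega> (\<lambda>\<xi>. l \<xi> *\<^sub>R G \<xi>)"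
    unfolding laplace_null_def
  proof
    fix v assume v: "v \<in> \<Omega>"
    let ?s = "\<lambda>k \<xi>. exp (- (v \<bullet> \<xi>)) *\<^sub>R (m k \<xi> *\<^sub>R G \<xi>)"
    let ?f = "\<lambda>\<xi>. exp (- (v \<bullet> \<xi>)) *\<^sub>R (l \<xi> *\<^sub>R G \<xi>)"
    let ?w = "\<lambda>\<xi>. norm (exp (- (v \<bullet> \<xi>)) *\<^sub>R G \<xi>)"
    have s: "integrable ?M (?s k)" "integral\<^sup>L ?M (?s k) = 0" for k
      using m[of k] G v by (auto simp: null_multiplier_def laplace_null_def)
    have lim': "(\<lambda>k. ?s k \<xi>) \<longlonglongrightarrow> ?f \<xi>" if "\<xi> \<in> dual_cone \<Omega>" for \<xi>
      by (intro tendsto_intros lim that)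
    have s_meas: "?s k \<in> borel_measurable ?M" for k
      using s(1) by (rule borel_measurable_integrable)
    have f_meas: "?f \<in> borel_measurable ?M"
      by (rule borel_measurable_LIMSEQ_metric[OF s_meas]) (use lim' in simp)
    have w_int: "integrable ?M ?w"
      using G v unfolding laplace_null_def by (intro integrable_norm) blast
    have AE_lim: "AE \<xi> in ?M. (\<lambda>k. ?s k \<xi>) \<longlonglongrightarrow> ?f \<xi>"
      by (rule AE_I2) (use lim' in simp)
    have AE_bound: "AE \<xi> in ?M. norm (?s k \<xi>) \<le> ?w \<xi>" for k
    proof (rule AE_I2)
      fix \<xi> assume "\<xi> \<in> space ?M"
      then have "\<bar>m k \<xi>\<bar> * norm (G \<xi>) \<le> 1 * norm (G \<xi>)"
        by (intro mult_right_mono bound) auto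
      then have "exp (- (v \<bullet> \<xi>)) * (\<bar>m k \<xi>\<bar> * norm (G \<xi>)) \<le> exp (- (v \<bullet> \<xi>)) * norm (G \<xi>)"
        by (intro mult_left_mono) auto
      then show "norm (?s k \<xi>) \<le> ?w \<xi>" by (simp add: abs_mult mult.assoc)
    qed
    note dc = f_meas s_meas w_int AE_lim AE_bound
    have "(\<lambda>k. integral\<^sup>L ?M (?s k)) \<longlonglongrightarrow> integral\<^sup>L ?M ?f"
      by (rule integral_dominated_convergence[OF dc])
    then have "integral\<^sup>L ?M ?f = 0"
      unfolding s(2) using LIMSEQ_unique tendsto_const by blast
    with integrable_dominated_convergence[OF dc]
    show "integrable ?M ?f \<and> integral\<^sup>L ?M ?f = 0" by blast
  qed
qed

lemma null_multiplier_one_on_dual_cone: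
  assumes "\<And>\<xi>. \<xi> \<in> dual_cone \<Omega> \<Longrightarrow> m \<xi> = 1"
  shows "null_multiplier \<Omega> m"
  by (rule null_multiplier_limit[OF null_multiplier_const[of \<Omega> 1]]) (use assms in auto)

text \<open>Null sets have to be treated separately, because the measurable sets of the measure are the Lebesgue
  sets, which half-spaces generate only up to null sets.\<close>

lemma null_multiplier_null_set:
  assumes "N \<in> null_sets lebesgue" shows "null_multiplier \<Omega> (indicator N)"
  unfolding null_multiplier_def
proof (intro allI impI)
  fix G assume G: "laplace_null \<Omega> G"
  let ?M = "dual_measure \<Omega>"
  show "laplace_null \<Omega> (\<lambda>\<xi>. indicator N \<xi> *\<^sub>R G \<xi>)"
    unfolding laplace_null_def
  proof
    fix v assume "v \<in> \<Omega>"
    then have int: "integrable ?M (\<lambda>\<xi>. exp (- (v \<bullet> \<xi>)) *\<^sub>R G \<xi>)"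
      using G by (auto simp: laplace_null_def)
    have "(indicator N :: _ \<Rightarrow> real) \<in> borel_measurable ?M"
      using assms by (intro measurable_restrict_space1 borel_measurable_indicator) auto
    then have meas: "(\<lambda>\<xi>. exp (- (v \<bullet> \<xi>)) *\<^sub>R (indicator N \<xi> *\<^sub>R G \<xi>)) \<in> borel_measurable ?M"
      using borel_measurable_scaleR[OF _ borel_measurable_integrable[OF int], of "indicator N"]
      by (simp add: mult.commute)
    have "AE \<xi> in lebesgue. \<xi> \<in> dual_cone \<Omega> \<longrightarrow> \<xi> \<notin> N"
      using AE_not_in[OF assms] by eventually_elim simp
    then have "AE \<xi> in ?M. \<xi> \<notin> N" by (simp add: AE_restrict_space_iff)
    then have ae: "AE \<xi> in ?M. exp (- (v \<bullet> \<xi>)) *\<^sub>R (indicator N \<xi> *\<^sub>R G \<xi>) = 0"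
      by eventually_elim simp
    have "integrable ?M (\<lambda>\<xi>. exp (- (v \<bullet> \<xi>)) *\<^sub>R (indicator N \<xi> *\<^sub>R G \<xi>))"
      using integrable_cong_AE[OF meas borel_measurable_const ae] by simp
    then show "integrable ?M (\<lambda>\<xi>. exp (- (v \<bullet> \<xi>)) *\<^sub>R (indicator N \<xi> *\<^sub>R G \<xi>)) \<and>
        integral\<^sup>L ?M (\<lambda>\<xi>. exp (- (v \<bullet> \<xi>)) *\<^sub>R (indicator N \<xi> *\<^sub>R G \<xi>)) = 0"
      using integral_eq_zero_AE[OF ae] by blast
  qed
qed

lemma null_multiplier_indicator_empty: "null_multiplier \<Omega> (indicator {})"
proof -
  have eq: "(indicator {} :: _ \<Rightarrow> real) = (\<lambda>\<xi>. 0)" by (simp add: fun_eq_iff)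
  show ?thesis unfolding eq by (rule null_multiplier_const)
qed

lemma null_multiplier_indicator_Un:
  assumes "null_multiplier \<Omega> (indicator A)" "null_multiplier \<Omega> (indicator B)"
  shows "null_multiplier \<Omega> (indicator (A \<union> B))"
proof -
  have "null_multiplier \<Omega> (\<lambda>\<xi>. indicator A \<xi> + indicator B \<xi> - indicator A \<xi> * indicator B \<xi>)"
    by (intro null_multiplier_add null_multiplier_diff null_multiplier_mult assms)
  moreover have "(\<lambda>\<xi>. indicator A \<xi> + indicator B \<xi> - indicator A \<xi> * indicator B \<xi>)
      = (indicator (A \<union> B) :: _ \<Rightarrow> real)"
    by (auto simp: indicator_def fun_eq_iff)
  ultimately show ?thesis by simp
qed

text \<open>Sums and products of multipliers give complements and finite unions, bounded limits give countable
  unions.\<close>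

lemma sigma_algebra_null_multiplier:
  "sigma_algebra UNIV {A. null_multiplier \<Omega> (indicator A)}"
  unfolding sigma_algebra_iff2
proof (intro conjI ballI allI impI)
  show "{} \<in> {A. null_multiplier \<Omega> (indicator A)}"
    using null_multiplier_indicator_empty by simp
next
  fix A assume "A \<in> {A. null_multiplier \<Omega> (indicator A)}"
  then have "null_multiplier \<Omega> (\<lambda>\<xi>. 1 - indicator A \<xi>)"
    by (intro null_multiplier_diff null_multiplier_const) simp
  moreover have "(\<lambda>\<xi>. 1 - indicator A \<xi>) = (indicator (UNIV - A) :: _ \<Rightarrow> real)"
    by (auto simp: indicator_def fun_eq_iff)
  ultimately show "UNIV - A \<in> {A. null_multiplier \<Omega> (indicator A)}" by simp
next
  fix A :: "nat \<Rightarrow> (real^'a) set"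
  assume "range A \<subseteq> {A. null_multiplier \<Omega> (indicator A)}"
  then have A: "null_multiplier \<Omega> (indicator (A i))" for i by auto
  have "null_multiplier \<Omega> (indicator (\<Union>i<k. A i))" for k
  proof (induction k)
    case 0 then show ?case using null_multiplier_const[of \<Omega> 0] by simp
  next
    case (Suc k)
    then show ?case using null_multiplier_indicator_Un[OF A[of k]] by (simp add: lessThan_Suc)
  qed
  then have "null_multiplier \<Omega> (indicator (\<Union>i. A i))"
    by (rule null_multiplier_limit) (simp, rule LIMSEQ_indicator_UN)
  then show "(\<Union>i. A i) \<in> {A. null_multiplier \<Omega> (indicator A)}" by simp
qed simp

text \<open>The polynomials \<open>(1 - u\<^sup>k)\<^sup>m\<close> with \<open>m = k 2\<^sup>k\<close> approximate a step function on \<open>[0,1]\<close>: \<open>m u\<^sup>k = k (2u)\<^sup>k\<close>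
  tends to \<open>0\<close> for \<open>u < 1/2\<close> and to infinity for \<open>u \<ge> 1/2\<close>. The factor \<open>k\<close> in the exponent settles the
  boundary point \<open>u = 1/2\<close>. Bernoulli's inequality gives the first limit, \<open>1 - x \<le> e\<^sup>-\<^sup>x\<close> the second.\<close>

lemma threshold_limit_below:
  fixes u :: real assumes "0 \<le> u" "u < 1/2"
  shows "(\<lambda>k. (1 - u ^ k) ^ (k * 2 ^ k)) \<longlonglongrightarrow> 1"
proof (rule tendsto_sandwich)
  have u1: "u ^ k \<le> 1" for k using assms by (intro power_le_one) auto
  show "\<forall>\<^sub>F k in sequentially. 1 - real k * (2 * u) ^ k \<le> (1 - u ^ k) ^ (k * 2 ^ k)"
  proof (intro always_eventually allI)
    fix k
    have "1 + real (k * 2 ^ k) * (- (u ^ k)) \<le> (1 + - (u ^ k)) ^ (k * 2 ^ k)"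
      using u1[of k] by (intro Bernoulli_inequality) simp
    then show "1 - real k * (2 * u) ^ k \<le> (1 - u ^ k) ^ (k * 2 ^ k)"
      by (simp add: power_mult_distrib mult.assoc)
  qed
  show "\<forall>\<^sub>F k in sequentially. (1 - u ^ k) ^ (k * 2 ^ k) \<le> 1"
    using u1 assms by (intro always_eventually allI power_le_one) auto
  have "(\<lambda>k. real k * (2 * u) ^ k) \<longlonglongrightarrow> 0"
    using assms by (intro powser_times_n_limit_0) simp
  from tendsto_diff[OF tendsto_const[of 1] this]
  show "(\<lambda>k. 1 - real k * (2 * u) ^ k) \<longlonglongrightarrow> 1" by simp
qed simp

lemma threshold_limit_above:
  fixes u :: real assumes "1/2 \<le> u" "u \<le> 1"
  shows "(\<lambda>k. (1 - u ^ k) ^ (k * 2 ^ k)) \<longlonglongrightarrow> 0"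
proof (rule tendsto_sandwich)
  have u1: "u ^ k \<le> 1" for k using assms by (intro power_le_one) auto
  show "\<forall>\<^sub>F k in sequentially. 0 \<le> (1 - u ^ k) ^ (k * 2 ^ k)"
    using u1 by (intro always_eventually allI zero_le_power) simp
  show "\<forall>\<^sub>F k in sequentially. (1 - u ^ k) ^ (k * 2 ^ k) \<le> exp (- 1) ^ k"
  proof (intro always_eventually allI)
    fix k
    have "(1 - u ^ k) ^ (k * 2 ^ k) \<le> exp (- (u ^ k)) ^ (k * 2 ^ k)"
      using u1[of k] exp_ge_add_one_self[of "- (u ^ k)"] by (intro power_mono) auto
    also have "\<dots> = exp (- (real k * (2 * u) ^ k))"
      by (simp add: exp_of_nat_mult[symmetric] power_mult_distrib mult.assoc)
    also have "1 \<le> (2 * u) ^ k" using assms by (intro one_le_power) simp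
    then have "real k * 1 \<le> real k * (2 * u) ^ k" by (intro mult_left_mono) auto
    then have "exp (- (real k * (2 * u) ^ k)) \<le> exp (real k * (- 1))" by simp
    also have "\<dots> = exp (- 1) ^ k" by (rule exp_of_nat_mult)
    finally show "(1 - u ^ k) ^ (k * 2 ^ k) \<le> exp (- 1) ^ k" .
  qed
  show "(\<lambda>k. exp (- 1 :: real) ^ k) \<longlonglongrightarrow> 0" by (intro LIMSEQ_power_zero) simp
qed simp

text \<open>Here \<open>u = e\<^bsup>-\<langle>w,\<xi>\<rangle>\<^esup>\<close> lies in \<open>[0,1]\<close> on the dual cone, and \<open>u < 1/2\<close> defines the half-space.\<close>

lemma null_multiplier_halfspace_ln2:
  assumes "open_convex_cone \<Omega>" "w \<in> \<Omega>"
  shows "null_multiplier \<Omega> (indicator {\<xi>. ln 2 < w \<bullet> \<xi>})"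
proof (rule null_multiplier_limit)
  let ?m = "\<lambda>k \<xi>. (1 - exp (- (w \<bullet> \<xi>)) ^ k) ^ (k * 2 ^ k)"
  show "null_multiplier \<Omega> (?m k)" for k
    by (intro null_multiplier_power null_multiplier_diff null_multiplier_const
        null_multiplier_exp assms)
  fix \<xi> assume "\<xi> \<in> dual_cone \<Omega>"
  then have "0 \<le> w \<bullet> \<xi>" using assms by (auto simp: dual_cone_def)
  then have u: "exp (- (w \<bullet> \<xi>)) \<le> 1" by simp
  then have uk: "exp (- (w \<bullet> \<xi>)) ^ k \<le> 1" for k by (intro power_le_one) auto
  show "\<bar>?m k \<xi>\<bar> \<le> 1" for k
    using uk[of k] by (auto simp: power_abs intro!: power_le_one)
  have half: "exp (- (w \<bullet> \<xi>)) < 1/2 \<longleftrightarrow> ln 2 < w \<bullet> \<xi>"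
  proof -
    have "exp (- (w \<bullet> \<xi>)) < 1/2 \<longleftrightarrow> exp (- (w \<bullet> \<xi>)) < exp (- ln 2)" by (simp add: exp_minus)
    then show ?thesis by simp
  qed
  show "(\<lambda>k. ?m k \<xi>) \<longlonglongrightarrow> indicator {\<xi>. ln 2 < w \<bullet> \<xi>} \<xi>"
  proof (cases "ln 2 < w \<bullet> \<xi>")
    case True
    then show ?thesis using threshold_limit_below[of "exp (- (w \<bullet> \<xi>))"] half by simp
  next
    case False
    then have "1/2 \<le> exp (- (w \<bullet> \<xi>))" using half by linarith
    then show ?thesis using threshold_limit_above[of "exp (- (w \<bullet> \<xi>))"] False u by simp
  qed
qed

text \<open>Rescaling \<open>w\<close> within the cone moves the threshold \<open>ln 2\<close> to any positive value, and nonnegativity of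
  \<open>\<langle>w,\<xi>\<rangle>\<close> on the dual cone covers the other values. Hence \<open>\<xi> \<mapsto> \<langle>w,\<xi>\<rangle>\<close> is measurable for the
  \<open>\<sigma>\<close>-algebra of the multiplier sets. As \<open>\<Omega>\<close> is open, each coordinate is a multiple of the difference of two such
  functions, so this \<open>\<sigma>\<close>-algebra contains the Borel sets.\<close>

lemma null_multiplier_lebesgue:
  assumes cone: "open_convex_cone \<Omega>" "\<Omega> \<noteq> {}" and L: "L \<in> sets lebesgue"
  shows "null_multiplier \<Omega> (indicator L)"
proof -
  let ?A = "{A. null_multiplier \<Omega> (indicator A)}"
  define N where "N = sigma UNIV ?A"
  interpret sigma_algebra UNIV ?A by (rule sigma_algebra_null_multiplier)
  have space_N: "space N = UNIV" and sets_N: "sets N = ?A"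
    using sigma_sets_eq by (simp_all add: N_def)
  have pos: "{\<xi>. t < w \<bullet> \<xi>} \<in> ?A" if "0 < t" "w \<in> \<Omega>" for t w
  proof -
    have "(ln 2 / t) *\<^sub>R w \<in> \<Omega>" using that by (intro cone_scale[OF cone(1)]) auto
    from null_multiplier_halfspace_ln2[OF cone(1) this] show ?thesis
      using that by (simp add: field_simps)
  qed
  have half: "(\<lambda>\<xi>. w \<bullet> \<xi>) \<in> borel_measurable N" if w: "w \<in> \<Omega>" for w
    unfolding borel_measurable_iff_greater space_N sets_N
  proof
    fix t :: real
    consider "0 < t" | "t = 0" | "t < 0" by linarith
    then show "{\<xi> \<in> UNIV. t < w \<bullet> \<xi>} \<in> ?A"
    proof cases
      case 1 then show ?thesis using pos w by simp
    next
      case 2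
      have "{\<xi>. 0 < w \<bullet> \<xi>} = (\<Union>k. {\<xi>. inverse (real (Suc k)) < w \<bullet> \<xi>})"
        using reals_Archimedean by (auto intro: less_trans[rotated])
      also have "\<dots> \<in> ?A" by (intro countable_UN image_subsetI pos w) simp
      finally show ?thesis using 2 by simp
    next
      case 3
      have "null_multiplier \<Omega> (indicator {\<xi>. t < w \<bullet> \<xi>})"
      proof (rule null_multiplier_one_on_dual_cone)
        fix \<xi> assume "\<xi> \<in> dual_cone \<Omega>"
        then have "0 \<le> w \<bullet> \<xi>" using w by (auto simp: dual_cone_def)
        then show "indicator {\<xi>. t < w \<bullet> \<xi>} \<xi> = (1::real)" using 3 by simp
      qed
      then show ?thesis by simp
    qed
  qed
  obtain y r where r: "0 < r" "cball y r \<subseteq> \<Omega>"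
    using cone unfolding open_convex_cone_def open_contains_cball by blast
  have "(\<lambda>\<xi>. \<xi>) \<in> borel_measurable N"
  proof (rule borel_measurable_euclidean_space[THEN iffD2], rule ballI)
    fix e :: "real^'a" assume "e \<in> Basis"
    then have "y + r *\<^sub>R e \<in> cball y r" "y \<in> cball y r" using r(1) by (simp_all add: dist_norm)
    then have "y + r *\<^sub>R e \<in> \<Omega>" "y \<in> \<Omega>" using r(2) by blast+
    then have "(\<lambda>\<xi>. ((y + r *\<^sub>R e) \<bullet> \<xi> - y \<bullet> \<xi>) / r) \<in> borel_measurable N"
      by (intro borel_measurable_divide borel_measurable_diff half) auto
    then show "(\<lambda>\<xi>. \<xi> \<bullet> e) \<in> borel_measurable N"
      using r by (simp add: inner_add_left inner_add_right inner_commute)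
  qed
  from measurable_sets[OF this] have borel: "S \<in> ?A" if "S \<in> sets borel" for S
    using that by (simp add: space_N sets_N vimage_def)
  obtain S Z Z' where LS: "L = S \<union> Z" "Z \<subseteq> Z'" "Z' \<in> null_sets lborel" "S \<in> sets lborel"
    using L by (rule sets_completionE)
  then have "Z \<in> null_sets lebesgue" by (intro null_sets_completion_subset[OF LS(2)] null_sets_completionI)
  then have "null_multiplier \<Omega> (indicator Z)" by (rule null_multiplier_null_set)
  moreover have "null_multiplier \<Omega> (indicator S)" using borel[of S] LS(4) by simp
  ultimately show ?thesis unfolding LS(1) by (intro null_multiplier_indicator_Un)
qed

lemma sigma_finite_dual_measure: "sigma_finite_measure (dual_measure \<Omega>)"
proof (rule sigma_finite_measure_restrict_space)
  show "sigma_finite_measure (lebesgue :: (real^'a) measure)"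
  proof
    obtain C :: "(real^'a) set set" where "countable C" "C \<subseteq> sets lborel" "\<Union>C = space lborel"
        "\<forall>a\<in>C. emeasure lborel a \<noteq> \<infinity>"
      using lborel.sigma_finite_countable by blast
    then show "\<exists>C. countable C \<and> C \<subseteq> sets (lebesgue :: (real^'a) measure) \<and> \<Union>C = space lebesgue \<and>
        (\<forall>a\<in>C. emeasure lebesgue a \<noteq> \<infinity>)"
      by (intro exI[of _ C]) (auto simp: subset_iff)
  qed
qed simp

lemma laplace_null_imp_AE_zero:
  assumes cone: "open_convex_cone \<Omega>" "\<Omega> \<noteq> {}" and G: "laplace_null \<Omega> G"
  shows "AE \<xi> in dual_measure \<Omega>. G \<xi> = 0"
proof -
  obtain v where v: "v \<in> \<Omega>" using cone(2) by blast
  let ?k = "\<lambda>\<xi>. exp (- (v \<bullet> \<xi>)) *\<^sub>R G \<xi>"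
  have "AE \<xi> in dual_measure \<Omega>. ?k \<xi> = 0"
  proof (rule sigma_finite_measure.density_zero[OF sigma_finite_dual_measure])
    show "integrable (dual_measure \<Omega>) ?k" using G v by (simp add: laplace_null_def)
    fix L assume "L \<in> sets (dual_measure \<Omega>)"
    then have "L \<in> sets lebesgue" by (auto simp: sets_restrict_space_iff)
    from null_multiplier_lebesgue[OF cone this] G
    have "laplace_null \<Omega> (\<lambda>\<xi>. indicator L \<xi> *\<^sub>R G \<xi>)" by (simp add: null_multiplier_def)
    with v have "integral\<^sup>L (dual_measure \<Omega>) (\<lambda>\<xi>. exp (- (v \<bullet> \<xi>)) *\<^sub>R (indicator L \<xi> *\<^sub>R G \<xi>)) = 0"
      by (simp only: laplace_null_def)
    then show "set_lebesgue_integral (dual_measure \<Omega>) L ?k = 0"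
      by (simp only: set_lebesgue_integral_def scaleR_left_commute)
  qed
  then show ?thesis by eventually_elim simp
qed

lemma FL_eq_0_imp_AE_zero:
  assumes cone: "open_convex_cone \<Omega>" "\<Omega> \<noteq> {}"
    and int: "\<And>z. z \<in> tube \<Omega> \<Longrightarrow> integrable (dual_measure \<Omega>) (FL_integrand f z)"
    and zero: "\<And>z. z \<in> tube \<Omega> \<Longrightarrow> FL \<Omega> f z = 0"
  shows "AE \<xi> in dual_measure \<Omega>. f \<xi> = 0"
proof (rule laplace_null_imp_AE_zero[OF cone])
  show "laplace_null \<Omega> f" unfolding laplace_null_def
  proof
    fix v assume v: "v \<in> \<Omega>"
    \<comment> \<open>at \<open>z = iv\<close> the kernel is the real exponential \<open>e\<^bsup>-\<langle>v,\<xi>\<rangle>\<^esup>\<close>\<close>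
    define z :: "complex^'a" where "z = (\<chi> j. \<i> * complex_of_real (v $ j))"
    have z: "z \<in> tube \<Omega>" using v by (simp add: tube_def z_def)
    have "\<i> * bilin z \<xi> = complex_of_real (- (v \<bullet> \<xi>))" for \<xi>
      by (simp add: bilin_def z_def inner_vec_def sum_distrib_left mult.assoc[symmetric] sum_negf)
    then have "FL_integrand f z = (\<lambda>\<xi>. exp (- (v \<bullet> \<xi>)) *\<^sub>R f \<xi>)"
      unfolding FL_integrand_def by (simp only: exp_of_real scaleR_conv_of_real)
    then show "integrable (dual_measure \<Omega>) (\<lambda>\<xi>. exp (- (v \<bullet> \<xi>)) *\<^sub>R f \<xi>) \<and>
        integral\<^sup>L (dual_measure \<Omega>) (\<lambda>\<xi>. exp (- (v \<bullet> \<xi>)) *\<^sub>R f \<xi>) = 0"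
      using int[OF z] zero[OF z] z by (simp add: FL_def)
  qed
qed

section \<open>Transport of the Hilbert space structure\<close>

locale dual_cone_L2 =
  fixes \<Omega> :: "(real^'d) set" and \<rho> :: "real^'d \<Rightarrow> real" and n :: nat
  assumes nonempty: "\<Omega> \<noteq> {}"
    and cone: "open_convex_cone \<Omega>"
    and continuous: "continuous_on (dual_cone \<Omega>) \<rho>"

sublocale dual_cone_L2 \<subseteq> weighted_L2 "dual_measure \<Omega>" "weight \<rho> n"
proof
  have [measurable]: "\<rho> \<in> borel_measurable (dual_measure \<Omega>)"
    by (rule continuous_imp_measurable_on_sets_lebesgue[OF continuous dual_cone_lebesgue])
  show "weight \<rho> n \<in> borel_measurable (dual_measure \<Omega>)"
    unfolding weight_def[abs_def] by measurable
  fix \<xi> :: "real^'d"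
  have "\<rho> \<xi> ^ (2 * 0) \<le> weight \<rho> n \<xi>"
    unfolding weight_def by (rule member_le_sum) (auto simp: power_mult)
  then show "1 \<le> weight \<rho> n \<xi>" by simp
qed

context dual_cone_L2
begin

lemma L2_fun_iff: "f \<in> L2_fun \<Omega> \<rho> n \<longleftrightarrow> sq_integrable f"
  by (simp add: L2_fun_def sq_integrable_def)

lemma L2_fun_norm_eq: "L2_fun_norm \<Omega> \<rho> n f = sqrt (norm_sq f)"
  by (simp add: L2_fun_norm_def norm_sq_def)

lemma integrable_unweighted:
  assumes "sq_integrable f" shows "integrable (dual_measure \<Omega>) (\<lambda>\<xi>. (cmod (f \<xi>))\<^sup>2)"
proof -
  have [measurable]: "f \<in> borel_measurable (dual_measure \<Omega>)"
    using assms by (rule sq_integrable_measurable)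
  have "integrable (dual_measure \<Omega>) (\<lambda>\<xi>. (cmod (f \<xi>))\<^sup>2 * weight \<rho> n \<xi>)"
    using assms by (simp add: sq_integrable_def)
  then show ?thesis
  proof (rule Bochner_Integration.integrable_bound)
    show "AE \<xi> in dual_measure \<Omega>. norm ((cmod (f \<xi>))\<^sup>2) \<le> norm ((cmod (f \<xi>))\<^sup>2 * weight \<rho> n \<xi>)"
    proof (rule AE_I2)
      fix \<xi> assume "\<xi> \<in> space (dual_measure \<Omega>)"
      then have "1 \<le> weight \<rho> n \<xi>" by (rule weight_ge_1)
      then show "norm ((cmod (f \<xi>))\<^sup>2) \<le> norm ((cmod (f \<xi>))\<^sup>2 * weight \<rho> n \<xi>)"
        using mult_left_mono[of 1 "weight \<rho> n \<xi>" "(cmod (f \<xi>))\<^sup>2"] by (simp add: abs_mult)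
    qed
  qed measurable
qed

lemma FL_integrable:
  assumes "sq_integrable f" "z \<in> tube \<Omega>"
  shows "integrable (dual_measure \<Omega>) (FL_integrand f z)"
  using cone assms
  by (intro FL_integrand_integrable integrable_unweighted sq_integrable_measurable)
     (auto simp: open_convex_cone_def)

lemma FL_in_holomorphic:
  assumes "sq_integrable f" shows "FL \<Omega> f \<in> holomorphic_functions (tube \<Omega>)"
  using cone assms
  by (intro FL_holomorphic integrable_unweighted sq_integrable_measurable)
     (auto simp: open_convex_cone_def)

lemma FL_add:
  assumes "sq_integrable f" "sq_integrable g"
  shows "FL \<Omega> (\<lambda>\<xi>. f \<xi> + g \<xi>) = (\<lambda>z. FL \<Omega> f z + FL \<Omega> g z)"
proof
  fix z
  have "FL_integrand (\<lambda>\<xi>. f \<xi> + g \<xi>) z = (\<lambda>\<xi>. FL_integrand f z \<xi> + FL_integrand g z \<xi>)"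
    by (simp add: FL_integrand_def fun_eq_iff distrib_left)
  then show "FL \<Omega> (\<lambda>\<xi>. f \<xi> + g \<xi>) z = FL \<Omega> f z + FL \<Omega> g z"
    using FL_integrable[OF assms(1)] FL_integrable[OF assms(2)] by (simp add: FL_def)
qed

lemma FL_scale: "FL \<Omega> (\<lambda>\<xi>. a * f \<xi>) = (\<lambda>z. a * FL \<Omega> f z)"
proof
  fix z
  have "FL_integrand (\<lambda>\<xi>. a * f \<xi>) z = (\<lambda>\<xi>. a * FL_integrand f z \<xi>)"
    by (simp add: FL_integrand_def fun_eq_iff)
  then show "FL \<Omega> (\<lambda>\<xi>. a * f \<xi>) z = a * FL \<Omega> f z" by (simp add: FL_def)
qed

lemma FL_zero: "FL \<Omega> (\<lambda>\<xi>. 0) = (\<lambda>z. 0)"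
  using FL_scale[of 0 "\<lambda>\<xi>. 0"] by simp

lemma FL_diff:
  assumes "sq_integrable f" "sq_integrable g"
  shows "FL \<Omega> (\<lambda>\<xi>. f \<xi> - g \<xi>) = (\<lambda>z. FL \<Omega> f z - FL \<Omega> g z)"
  using FL_add[OF assms(1) sq_integrable_scale[OF assms(2), of "-1"]] FL_scale[of "-1" g] by simp

text \<open>Well-definedness and injectivity in one statement. It allows the relation of almost-everywhere equality
  to be replaced by equality of transforms, which is what makes the computations in the quotient short.\<close>

lemma FL_eq_iff:
  assumes "sq_integrable f" "sq_integrable g"
  shows "FL \<Omega> f = FL \<Omega> g \<longleftrightarrow> (AE \<xi> in dual_measure \<Omega>. f \<xi> = g \<xi>)"
proof
  assume eq: "FL \<Omega> f = FL \<Omega> g"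
  have d: "sq_integrable (\<lambda>\<xi>. f \<xi> - g \<xi>)" using assms by (rule sq_integrable_diff)
  have "AE \<xi> in dual_measure \<Omega>. f \<xi> - g \<xi> = 0"
    by (rule FL_eq_0_imp_AE_zero[OF cone nonempty FL_integrable[OF d]])
       (simp_all add: FL_diff[OF assms] eq)
  then show "AE \<xi> in dual_measure \<Omega>. f \<xi> = g \<xi>" by simp
next
  assume ae: "AE \<xi> in dual_measure \<Omega>. f \<xi> = g \<xi>"
  show "FL \<Omega> f = FL \<Omega> g"
  proof
    fix z
    have "AE \<xi> in dual_measure \<Omega>. FL_integrand f z \<xi> = FL_integrand g z \<xi>"
      using ae by eventually_elim (simp add: FL_integrand_def)
    then have "integral\<^sup>L (dual_measure \<Omega>) (FL_integrand f z)
        = integral\<^sup>L (dual_measure \<Omega>) (FL_integrand g z)"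
      using assms by (intro integral_cong_AE FL_integrand_measurable sq_integrable_measurable)
    then show "FL \<Omega> f z = FL \<Omega> g z" by (simp add: FL_def)
  qed
qed

abbreviation ae_class :: "(real^'d \<Rightarrow> complex) \<Rightarrow> (real^'d \<Rightarrow> complex) set" where
  "ae_class f \<equiv> L2_rel \<Omega> \<rho> n `` {f}"

lemma L2_rel_iff:
  "(f, g) \<in> L2_rel \<Omega> \<rho> n \<longleftrightarrow>
     sq_integrable f \<and> sq_integrable g \<and> (AE \<xi> in dual_measure \<Omega>. f \<xi> = g \<xi>)"
  by (auto simp: L2_rel_def L2_fun_iff)

lemma L2_rel_iff_FL:
  "(f, g) \<in> L2_rel \<Omega> \<rho> n \<longleftrightarrow> sq_integrable f \<and> sq_integrable g \<and> FL \<Omega> f = FL \<Omega> g"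
  using FL_eq_iff by (auto simp: L2_rel_iff)

lemma equiv_L2_rel: "equiv (L2_fun \<Omega> \<rho> n) (L2_rel \<Omega> \<rho> n)"
  by (rule equivI)
     (auto simp: refl_on_def sym_def trans_def L2_rel_iff_FL L2_fun_iff)

lemma ae_class_eq_iff:
  assumes "sq_integrable f" "sq_integrable g"
  shows "ae_class f = ae_class g \<longleftrightarrow> FL \<Omega> f = FL \<Omega> g"
  using eq_equiv_class_iff[OF equiv_L2_rel] assms by (simp add: L2_fun_iff L2_rel_iff_FL)

lemma L2_carrier: "vcarrier (L2 \<Omega> \<rho> n) = {ae_class f | f. sq_integrable f}"
  by (auto simp: L2_def quotient_def L2_fun_iff)

lemma L2_zero: "vzero (L2 \<Omega> \<rho> n) = ae_class (\<lambda>\<xi>. 0)"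
  by (simp add: L2_def)

lemma L2_add:
  assumes "sq_integrable f" "sq_integrable g"
  shows "vadd (L2 \<Omega> \<rho> n) (ae_class f) (ae_class g) = ae_class (\<lambda>\<xi>. f \<xi> + g \<xi>)"
proof -
  have "congruent2 (L2_rel \<Omega> \<rho> n) (L2_rel \<Omega> \<rho> n) (\<lambda>f g. ae_class (\<lambda>\<xi>. f \<xi> + g \<xi>))"
    by (auto simp: congruent2_def L2_rel_iff_FL ae_class_eq_iff sq_integrable_add FL_add)
  from UN_equiv_class2[OF equiv_L2_rel equiv_L2_rel this] assms show ?thesis
    by (simp add: L2_def L2_fun_iff)
qed

lemma L2_scale:
  assumes "sq_integrable f"
  shows "vscale (L2 \<Omega> \<rho> n) a (ae_class f) = ae_class (\<lambda>\<xi>. a * f \<xi>)"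
proof -
  have "congruent (L2_rel \<Omega> \<rho> n) (\<lambda>f. ae_class (\<lambda>\<xi>. a * f \<xi>))"
    by (auto simp: congruent_def L2_rel_iff_FL ae_class_eq_iff sq_integrable_scale FL_scale)
  from UN_equiv_class[OF equiv_L2_rel this] assms show ?thesis
    by (simp add: L2_def L2_fun_iff)
qed

lemma the_elem_ae_class:
  assumes "sq_integrable f" "\<And>g. (f, g) \<in> L2_rel \<Omega> \<rho> n \<Longrightarrow> h g = h f"
  shows "the_elem (h ` ae_class f) = h f"
proof -
  have "f \<in> ae_class f" using assms(1) by (simp add: L2_rel_iff)
  moreover have "h g = h f" if "g \<in> ae_class f" for g using assms(2) that by blast
  ultimately have "h ` ae_class f = {h f}" by blast
  then show ?thesis by simp
qed

lemma FL_class_eq: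
  assumes "sq_integrable f" shows "FL_class \<Omega> (ae_class f) = FL \<Omega> f"
  unfolding FL_class_def by (rule the_elem_ae_class[OF assms]) (simp add: L2_rel_iff_FL)

lemma L2_norm_eq:
  assumes "sq_integrable f" shows "L2_norm \<Omega> \<rho> n (ae_class f) = sqrt (norm_sq f)"
  unfolding L2_norm_def L2_fun_norm_eq[abs_def]
  by (rule the_elem_ae_class[OF assms]) (auto simp: L2_rel_iff dest: norm_sq_cong_AE)

lemma ae_class_in_carrier: "sq_integrable f \<Longrightarrow> ae_class f \<in> vcarrier (L2 \<Omega> \<rho> n)"
  by (auto simp: L2_carrier)

lemma L2_carrierE:
  assumes "A \<in> vcarrier (L2 \<Omega> \<rho> n)" obtains f where "sq_integrable f" "A = ae_class f"
  using assms by (auto simp: L2_carrier)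

lemma vector_space_L2: "complex_vector_space (L2 \<Omega> \<rho> n)"
proof
  show "vadd (L2 \<Omega> \<rho> n) A (vscale (L2 \<Omega> \<rho> n) (- 1) A) = vzero (L2 \<Omega> \<rho> n)"
    if A: "A \<in> vcarrier (L2 \<Omega> \<rho> n)" for A
  proof -
    obtain f where f: "sq_integrable f" "A = ae_class f" using A by (rule L2_carrierE)
    show ?thesis unfolding f(2) L2_scale[OF f(1)] L2_add[OF f(1) sq_integrable_scale[OF f(1)]] L2_zero
      by simp
  qed
qed (auto elim!: L2_carrierE simp: ae_class_in_carrier L2_zero L2_add L2_scale sq_integrable_zero sq_integrable_add
       sq_integrable_scale algebra_simps)

lemma hardy_carrier: "vcarrier (hardy_sobolev \<Omega> \<rho> n) = {FL \<Omega> f | f. sq_integrable f}"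
  using FL_in_holomorphic by (auto simp: hardy_sobolev_def L2_fun_iff)

lemma hardy_ops:
  "vzero (hardy_sobolev \<Omega> \<rho> n) = (\<lambda>z. 0)"
  "vadd (hardy_sobolev \<Omega> \<rho> n) F G = (\<lambda>z. F z + G z)"
  "vscale (hardy_sobolev \<Omega> \<rho> n) a F = (\<lambda>z. a * F z)"
  by (simp_all add: hardy_sobolev_def)

lemma vector_space_hardy: "complex_vector_space (hardy_sobolev \<Omega> \<rho> n)"
proof
  show "vzero (hardy_sobolev \<Omega> \<rho> n) \<in> vcarrier (hardy_sobolev \<Omega> \<rho> n)"
    using FL_zero[symmetric] sq_integrable_zero by (auto simp: hardy_carrier hardy_ops)
  show "vadd (hardy_sobolev \<Omega> \<rho> n) F G \<in> vcarrier (hardy_sobolev \<Omega> \<rho> n)"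
    if FG: "F \<in> vcarrier (hardy_sobolev \<Omega> \<rho> n)" "G \<in> vcarrier (hardy_sobolev \<Omega> \<rho> n)" for F G
  proof -
    obtain f g where "F = FL \<Omega> f" "G = FL \<Omega> g" and fg: "sq_integrable f" "sq_integrable g"
      using FG by (auto simp: hardy_carrier)
    then show ?thesis
      using FL_add[OF fg, symmetric] sq_integrable_add[OF fg] by (auto simp: hardy_carrier hardy_ops)
  qed
  show "vscale (hardy_sobolev \<Omega> \<rho> n) a F \<in> vcarrier (hardy_sobolev \<Omega> \<rho> n)"
    if F: "F \<in> vcarrier (hardy_sobolev \<Omega> \<rho> n)" for a F
  proof -
    obtain f where "F = FL \<Omega> f" and f: "sq_integrable f"
      using F by (auto simp: hardy_carrier)
    then show ?thesis
      using FL_scale[of a f, symmetric] sq_integrable_scale[OF f] by (auto simp: hardy_carrier hardy_ops)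
  qed
qed (simp_all add: hardy_ops fun_eq_iff algebra_simps)

definition pairing :: "(real^'d \<Rightarrow> complex) \<Rightarrow> (real^'d \<Rightarrow> complex) \<Rightarrow> complex" where
  "pairing f g = integral\<^sup>L (dual_measure \<Omega>)
     (\<lambda>\<xi>. f \<xi> * cnj (g \<xi>) * complex_of_real (weight \<rho> n \<xi>))"

lemma pairing_cong:
  assumes "(f, f') \<in> L2_rel \<Omega> \<rho> n" "(g, g') \<in> L2_rel \<Omega> \<rho> n"
  shows "pairing f g = pairing f' g'"
  unfolding pairing_def
proof (rule integral_cong_AE)
  show "AE \<xi> in dual_measure \<Omega>. f \<xi> * cnj (g \<xi>) * complex_of_real (weight \<rho> n \<xi>)
      = f' \<xi> * cnj (g' \<xi>) * complex_of_real (weight \<rho> n \<xi>)"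
    using assms unfolding L2_rel_iff by (auto elim: eventually_elim2)
qed (use assms in \<open>auto simp: L2_rel_iff intro!: borel_measurable_integrable integrable_mult_weight\<close>)

lemma pairing_add:
  assumes "sq_integrable f" "sq_integrable g" "sq_integrable h"
  shows "pairing (\<lambda>\<xi>. f \<xi> + g \<xi>) h = pairing f h + pairing g h"
  using integrable_mult_weight[OF assms(1,3)] integrable_mult_weight[OF assms(2,3)]
  by (simp add: pairing_def distrib_right)

lemma pairing_scale: "pairing (\<lambda>\<xi>. a * f \<xi>) g = a * pairing f g"
  by (simp add: pairing_def mult.assoc)

lemma pairing_cnj: "cnj (pairing g f) = pairing f g"
  unfolding pairing_def Bochner_Integration.integral_cnj[symmetric] by (simp add: mult_ac)

text \<open>In particular the weighted norm is the norm induced by the pairing.\<close>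

lemma pairing_self: "pairing f f = complex_of_real (norm_sq f)"
  unfolding pairing_def norm_sq_def integral_complex_of_real[symmetric]
  by (simp only: of_real_mult complex_norm_square)

text \<open>A representative of the class with transform \<open>F\<close>; the choice is immaterial, as \<open>pairing\<close> depends only on
  classes.\<close>

definition symbol :: "(complex^'d \<Rightarrow> complex) \<Rightarrow> real^'d \<Rightarrow> complex" where
  "symbol F = (SOME f. sq_integrable f \<and> F = FL \<Omega> f)"

lemma symbol_FL:
  assumes "sq_integrable f" shows "(symbol (FL \<Omega> f), f) \<in> L2_rel \<Omega> \<rho> n"
proof -
  have "sq_integrable (symbol (FL \<Omega> f)) \<and> FL \<Omega> f = FL \<Omega> (symbol (FL \<Omega> f))"
    unfolding symbol_def by (rule someI[of _ f]) (simp add: assms)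
  then show ?thesis using assms by (simp add: L2_rel_iff_FL)
qed

definition hardy_ip :: "(complex^'d \<Rightarrow> complex) \<Rightarrow> (complex^'d \<Rightarrow> complex) \<Rightarrow> complex" where
  "hardy_ip F G = pairing (symbol F) (symbol G)"

lemma hardy_ip_FL:
  assumes "sq_integrable f" "sq_integrable g"
  shows "hardy_ip (FL \<Omega> f) (FL \<Omega> g) = pairing f g"
  unfolding hardy_ip_def by (intro pairing_cong symbol_FL assms)

lemma hardy_ip_norm:
  assumes "sq_integrable f" shows "ip_norm hardy_ip (FL \<Omega> f) = sqrt (norm_sq f)"
  by (simp add: ip_norm_def hardy_ip_FL assms pairing_self)

text \<open>By injectivity the infimum is taken over a one-element set.\<close>

lemma hs_norm_FL:
  assumes "sq_integrable f" shows "hs_norm \<Omega> \<rho> n (FL \<Omega> f) = sqrt (norm_sq f)"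
proof -
  have const: "L2_fun_norm \<Omega> \<rho> n g = sqrt (norm_sq f)"
    if g: "g \<in> L2_fun \<Omega> \<rho> n" "FL \<Omega> f = FL \<Omega> g" for g
  proof -
    have sg: "sq_integrable g" using g(1) by (simp add: L2_fun_iff)
    have "AE \<xi> in dual_measure \<Omega>. f \<xi> = g \<xi>" using FL_eq_iff[OF assms sg] g(2) by simp
    from norm_sq_cong_AE[OF this assms sg] show ?thesis by (simp add: L2_fun_norm_eq)
  qed
  have f: "f \<in> L2_fun \<Omega> \<rho> n" using assms by (simp add: L2_fun_iff)
  have "{L2_fun_norm \<Omega> \<rho> n g | g. g \<in> L2_fun \<Omega> \<rho> n \<and> FL \<Omega> f = FL \<Omega> g}
      = {sqrt (norm_sq f)}" (is "?N = _")
  proof (intro equalityI subsetI)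
    fix x assume "x \<in> ?N"
    then obtain g where "x = L2_fun_norm \<Omega> \<rho> n g" "g \<in> L2_fun \<Omega> \<rho> n" "FL \<Omega> f = FL \<Omega> g"
      by blast
    then show "x \<in> {sqrt (norm_sq f)}" using const[of g] by simp
  next
    fix x assume "x \<in> {sqrt (norm_sq f)}"
    then have "x = L2_fun_norm \<Omega> \<rho> n f" using const[OF f refl] by simp
    then show "x \<in> ?N" using f by blast
  qed
  then show ?thesis by (simp add: hs_norm_def)
qed

lemma hardy_vdist:
  assumes "sq_integrable f" "sq_integrable g"
  shows "vdist (hardy_sobolev \<Omega> \<rho> n) (ip_norm hardy_ip) (FL \<Omega> f) (FL \<Omega> g)
    = sqrt (norm_sq (\<lambda>\<xi>. f \<xi> - g \<xi>))"
  using hardy_ip_norm[OF sq_integrable_diff[OF assms]] FL_diff[OF assms]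
  by (simp add: vdist_def hardy_ops)

text \<open>The transform turns a Cauchy sequence of representatives into the given one, so completeness is inherited
  from the weighted \<open>L\<^sup>2\<close> space.\<close>

lemma hilbert_hardy: "complex_hilbert_space (hardy_sobolev \<Omega> \<rho> n) hardy_ip"
proof -
  interpret complex_vector_space "hardy_sobolev \<Omega> \<rho> n" by (rule vector_space_hardy)
  let ?H = "hardy_sobolev \<Omega> \<rho> n"
  have rep: "\<exists>f. sq_integrable f \<and> F = FL \<Omega> f" if "F \<in> vcarrier ?H" for F
    using that by (auto simp: hardy_carrier)
  show ?thesis
  proof
    fix F G K a
    assume "F \<in> vcarrier ?H" "G \<in> vcarrier ?H"
    then obtain f g where fg: "sq_integrable f" "F = FL \<Omega> f" "sq_integrable g" "G = FL \<Omega> g"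
      using rep by metis
    have "vscale ?H a F = FL \<Omega> (\<lambda>\<xi>. a * f \<xi>)"
      by (simp add: hardy_ops fg FL_scale)
    then show "hardy_ip (vscale ?H a F) G = a * hardy_ip F G"
      by (simp add: fg hardy_ip_FL sq_integrable_scale pairing_scale)
    show "hardy_ip F G = cnj (hardy_ip G F)"
      using fg by (simp add: hardy_ip_FL pairing_cnj)
    assume "K \<in> vcarrier ?H"
    then obtain k where k: "sq_integrable k" "K = FL \<Omega> k" using rep by metis
    have "vadd ?H F G = FL \<Omega> (\<lambda>\<xi>. f \<xi> + g \<xi>)"
      by (simp add: hardy_ops fg FL_add)
    then show "hardy_ip (vadd ?H F G) K = hardy_ip F K + hardy_ip G K"
      by (simp add: fg k hardy_ip_FL sq_integrable_add pairing_add)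
  next
    fix F assume "F \<in> vcarrier ?H"
    then obtain f where f: "sq_integrable f" "F = FL \<Omega> f" using rep by metis
    show "0 \<le> Re (hardy_ip F F)"
      using f by (simp add: hardy_ip_FL pairing_self norm_sq_nonneg)
    assume "hardy_ip F F = 0"
    then have "AE \<xi> in dual_measure \<Omega>. f \<xi> = 0"
      using f by (intro norm_sq_eq_0_imp_AE) (simp_all add: hardy_ip_FL pairing_self)
    then show "F = vzero ?H"
      using FL_eq_iff[OF f(1) sq_integrable_zero] f FL_zero by (simp add: hardy_ops)
  next
    fix s :: "nat \<Rightarrow> complex^'d \<Rightarrow> complex"
    assume s: "\<And>k. s k \<in> vcarrier ?H"
      and cauchy: "\<And>e. e > 0 \<Longrightarrow> \<exists>M. \<forall>j\<ge>M. \<forall>k\<ge>M. vdist ?H (ip_norm hardy_ip) (s j) (s k) < e"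
    have "\<forall>k. \<exists>f. sq_integrable f \<and> s k = FL \<Omega> f" using s rep by blast
    from choice[OF this] obtain f where f: "\<And>k. sq_integrable (f k)" "\<And>k. s k = FL \<Omega> (f k)"
      by blast
    obtain l where l: "sq_integrable l" "(\<lambda>k. norm_sq (\<lambda>\<xi>. f k \<xi> - l \<xi>)) \<longlonglongrightarrow> 0"
    proof (rule complete_L2[OF f(1)])
      fix e :: real assume "e > 0"
      then show "\<exists>K. \<forall>j\<ge>K. \<forall>k\<ge>K. norm_sq (\<lambda>\<xi>. f j \<xi> - f k \<xi>) < e"
        using cauchy[of "sqrt e"] f by (simp add: hardy_vdist)
    qed
    from tendsto_real_sqrt[OF l(2)] have "(\<lambda>k. vdist ?H (ip_norm hardy_ip) (s k) (FL \<Omega> l)) \<longlonglongrightarrow> 0"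
      using f l by (simp add: hardy_vdist)
    moreover have "FL \<Omega> l \<in> vcarrier ?H" using l by (auto simp: hardy_carrier)
    ultimately show "\<exists>L\<in>vcarrier ?H. (\<lambda>k. vdist ?H (ip_norm hardy_ip) (s k) L) \<longlonglongrightarrow> 0" by blast
  qed
qed

lemma inj_FL_class: "inj_on (FL_class \<Omega>) (vcarrier (L2 \<Omega> \<rho> n))"
proof (rule inj_onI)
  fix A B
  assume "A \<in> vcarrier (L2 \<Omega> \<rho> n)" "B \<in> vcarrier (L2 \<Omega> \<rho> n)"
    and eq: "FL_class \<Omega> A = FL_class \<Omega> B"
  then obtain f g where fg: "sq_integrable f" "A = ae_class f" "sq_integrable g" "B = ae_class g"
    by (elim L2_carrierE)
  from eq have "FL \<Omega> f = FL \<Omega> g" by (simp only: fg FL_class_eq)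
  then show "A = B" unfolding fg(2,4) ae_class_eq_iff[OF fg(1,3)] .
qed

lemma range_FL_class:
  "FL_class \<Omega> ` vcarrier (L2 \<Omega> \<rho> n) = vcarrier (hardy_sobolev \<Omega> \<rho> n)"
proof -
  have 1: "vcarrier (L2 \<Omega> \<rho> n) = ae_class ` Collect sq_integrable"
    unfolding L2_carrier by blast
  have 2: "vcarrier (hardy_sobolev \<Omega> \<rho> n) = FL \<Omega> ` Collect sq_integrable"
    unfolding hardy_carrier by blast
  show ?thesis
    unfolding 1 2 image_image by (rule image_cong) (simp_all add: FL_class_eq)
qed

lemma isometric_isomorphism_FL_class:
  "isometric_isomorphism (L2 \<Omega> \<rho> n) (L2_norm \<Omega> \<rho> n)
     (hardy_sobolev \<Omega> \<rho> n) (hs_norm \<Omega> \<rho> n) (FL_class \<Omega>)"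
  unfolding isometric_isomorphism_def
proof (intro conjI ballI allI vector_space_L2 vector_space_hardy)
  show "bij_betw (FL_class \<Omega>) (vcarrier (L2 \<Omega> \<rho> n)) (vcarrier (hardy_sobolev \<Omega> \<rho> n))"
    by (intro bij_betw_imageI inj_FL_class range_FL_class)
qed (auto simp: L2_carrier L2_add L2_scale FL_class_eq L2_norm_eq hs_norm_FL hardy_ops
      sq_integrable_add sq_integrable_scale FL_add FL_scale)

end

theorem theorem3p4:
  fixes \<Omega> :: "(real^'d) set" and \<rho> :: "real^'d \<Rightarrow> real" and n :: nat
  assumes "\<Omega> \<noteq> {}" and "open_convex_cone \<Omega>" and "\<not> contains_line \<Omega>"
    and "continuous_on (dual_cone \<Omega>) \<rho>"
    and "\<And>\<xi>. \<xi> \<in> dual_cone \<Omega> \<Longrightarrow> 0 \<le> \<rho> \<xi>"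
    and "\<And>\<xi>. \<xi> \<in> dual_cone \<Omega> \<Longrightarrow> \<xi> \<noteq> 0 \<Longrightarrow> 0 < \<rho> \<xi>"
    and "\<And>t \<xi>. 0 < t \<Longrightarrow> \<xi> \<in> dual_cone \<Omega> \<Longrightarrow> \<rho> (t *\<^sub>R \<xi>) = t * \<rho> \<xi>"
  shows
    "(\<forall>f\<in>L2_fun \<Omega> \<rho> n. \<forall>z\<in>tube \<Omega>. integrable (dual_measure \<Omega>) (FL_integrand f z)) \<and>
     FL \<Omega> respects L2_rel \<Omega> \<rho> n \<and>
     (\<forall>A\<in>vcarrier (L2 \<Omega> \<rho> n). FL_class \<Omega> A \<in> holomorphic_functions (tube \<Omega>)) \<and>
     inj_on (FL_class \<Omega>) (vcarrier (L2 \<Omega> \<rho> n)) \<and>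
     FL_class \<Omega> ` vcarrier (L2 \<Omega> \<rho> n) = vcarrier (hardy_sobolev \<Omega> \<rho> n) \<and>
     (\<forall>f\<in>L2_fun \<Omega> \<rho> n. \<forall>g\<in>L2_fun \<Omega> \<rho> n.
        integrable (dual_measure \<Omega>) (\<lambda>\<xi>. f \<xi> * cnj (g \<xi>) * complex_of_real (weight \<rho> n \<xi>))) \<and>
     (\<exists>ip. (\<forall>f\<in>L2_fun \<Omega> \<rho> n. \<forall>g\<in>L2_fun \<Omega> \<rho> n.
              ip (FL \<Omega> f) (FL \<Omega> g) =
              integral\<^sup>L (dual_measure \<Omega>)
                (\<lambda>\<xi>. f \<xi> * cnj (g \<xi>) * complex_of_real (weight \<rho> n \<xi>))) \<and>
           complex_hilbert_space (hardy_sobolev \<Omega> \<rho> n) ip \<and>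
           (\<forall>F\<in>vcarrier (hardy_sobolev \<Omega> \<rho> n). hs_norm \<Omega> \<rho> n F = ip_norm ip F)) \<and>
     isometric_isomorphism (L2 \<Omega> \<rho> n) (L2_norm \<Omega> \<rho> n)
       (hardy_sobolev \<Omega> \<rho> n) (hs_norm \<Omega> \<rho> n) (FL_class \<Omega>)"
proof -
  interpret dual_cone_L2 \<Omega> \<rho> n by (unfold_locales) (use assms in auto)
  show ?thesis
  proof (intro conjI ballI exI[of _ hardy_ip] inj_FL_class range_FL_class hilbert_hardy
      isometric_isomorphism_FL_class)
    show "FL \<Omega> respects L2_rel \<Omega> \<rho> n"
      by (auto simp: congruent_def L2_rel_iff_FL)
    show "FL_class \<Omega> A \<in> holomorphic_functions (tube \<Omega>)" if "A \<in> vcarrier (L2 \<Omega> \<rho> n)" for A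
      using that FL_in_holomorphic by (auto simp: L2_carrier FL_class_eq)
    show "hs_norm \<Omega> \<rho> n F = ip_norm hardy_ip F" if "F \<in> vcarrier (hardy_sobolev \<Omega> \<rho> n)" for F
      using that by (auto simp: hardy_carrier hs_norm_FL hardy_ip_norm)
  qed (simp_all add: L2_fun_iff FL_integrable integrable_mult_weight hardy_ip_FL pairing_def)
qed

end
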